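(* Assume that $k$ has characteristic different from $2$. The Hopf algebra $\mathcal O({\rm SL}(2)_J)$ does not have a dense big cell.
   Context: $k$ is an algebraically closed field (of characteristic different from $2$); Hopf algebras are over $k$; $\Delta(x)=x_{(1)}\otimes x_{(2)}$; ${\rm Gr}(H)$ is the group of group-likes. A Hopf algebra is pointed if all its simple comodules are one-dimensional. $\mathcal O({\rm SL}(2)_J)$ (Jordanian quantum ${\rm SL}(2)$) is the algebra generated by $a,b,c,d$ with relations $ca-ac=c^2=cd-dc$, $ba-ab=1-a^2$, $bd-db=1-d^2$, $ad-da=ac-dc$, $cb-bc=ac+cd$, $1=ad-bc-ac$. Its comultiplication and counit are those for which the matrix $\begin{pmatrix}a&b\\c&d\end{pmatrix}$ is multiplicative (a matrix $(x_{ij})$ is multiplicative if $\Delta(x_{ij})=\sum_k x_{ik}\otimes x_{kj}$ and $\varepsilon(x_{ij})=\delta_{ij}$), and its antipode is $S\begin{pmatrix}a&b\\c&d\end{pmatrix}=\begin{pmatrix}d-c&a-b+c-d\\-c&a+c\end{pmatrix}$. Dense big cell: a dense big cell for $H$ is a triple $(B,B',\Lambda)$ formed by two pointed Hopf algebras $B,B'$ and a discrete group $\Lambda$, together with surjective Hopf algebra maps $\pi:H\to B$, $\psi:B\to k\Lambda$, $\pi':H\to B'$, $\psi':B'\to k\Lambda$ such that: (1) $\psi\circ\pi=\psi'\circ\pi'$, and $\psi,\psi'$ induce group isomorphisms ${\rm Gr}(B)\simeq\Lambda$, ${\rm Gr}(B')\simeq\Lambda$; (2) the algebra map $\theta=(\pi\otimes\pi')\circ\Delta:H\to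 B\otimes B'$ is injective. *)

theory Defs
  imports
    "HOL-Library.Poly_Mapping"
    "HOL-Computational_Algebra.Polynomial"
begin

section \<open>Formal linear combinations\<close>

text \<open>
  \<^typ>\<open>'i \<Rightarrow>\<^sub>0 'k\<close> is the vector space with basis \<^typ>\<open>'i\<close>; \<^term>\<open>linext s f\<close> is the linear
  extension of \<^term>\<open>f\<close> from basis elements to formal linear combinations.
\<close>

abbreviation lookup :: "('i \<Rightarrow>\<^sub>0 'k::zero) \<Rightarrow> 'i \<Rightarrow> 'k" where
  "lookup \<equiv> Poly_Mapping.lookup"

abbreviation keys :: "('i \<Rightarrow>\<^sub>0 'k::zero) \<Rightarrow> 'i set" where
  "keys \<equiv> Poly_Mapping.keys"

abbreviation single :: "'i \<Rightarrow> 'k::zero \<Rightarrow> ('i \<Rightarrow>\<^sub>0 'k)" where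
  "single \<equiv> Poly_Mapping.single"

definition fscale :: "'k::field \<Rightarrow> ('i \<Rightarrow>\<^sub>0 'k) \<Rightarrow> ('i \<Rightarrow>\<^sub>0 'k)" where
  "fscale c p = Poly_Mapping.map ((*) c) p"

definition linext :: "('k::field \<Rightarrow> 'v \<Rightarrow> 'v) \<Rightarrow> ('i \<Rightarrow> 'v) \<Rightarrow> ('i \<Rightarrow>\<^sub>0 'k) \<Rightarrow> 'v::ab_group_add" where
  "linext s f p = (\<Sum>i\<in>keys p. s (lookup p i) (f i))"

abbreviation lin :: "('i \<Rightarrow> ('j \<Rightarrow>\<^sub>0 'k)) \<Rightarrow> ('i \<Rightarrow>\<^sub>0 'k) \<Rightarrow> ('j \<Rightarrow>\<^sub>0 'k::field)" where
  "lin \<equiv> linext fscale"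


section \<open>Vector spaces and tensor products\<close>

record ('k, 'v) vspace =
  car :: "'v set"
  scl :: "'k \<Rightarrow> 'v \<Rightarrow> 'v"

definition is_vspace :: "('k::field, 'v::ab_group_add) vspace \<Rightarrow> bool" where
  "is_vspace V \<longleftrightarrow> vector_space (scl V) \<and> module.subspace (scl V) (car V)"

text \<open>
  The relations which force the placement \<^term>\<open>e\<close> of a vector into a formal combination to be linear.
\<close>

definition slot_relations ::
  "('k::field, 'v::ab_group_add) vspace \<Rightarrow> ('v \<Rightarrow> 'i) \<Rightarrow> ('i \<Rightarrow>\<^sub>0 'k) set" where
  "slot_relations V e =
     {single (e (x + y)) 1 - single (e x) 1 - single (e y) 1 | x y. x \<in> car V \<and> y \<in> car V}
   \<union> {single (e (scl V c x)) 1 - single (e x) c | c x. x \<in> car V}"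

text \<open>
  \<open>V \<otimes> W\<close> is the quotient of the free vector space on \<open>V \<times> W\<close> by the bilinearity
  relations.  Its elements are cosets, i.e. sets of formal linear combinations of pairs.
\<close>

definition tnull ::
  "('k::field, 'v::ab_group_add) vspace \<Rightarrow> ('k, 'w::ab_group_add) vspace \<Rightarrow> ('v \<times> 'w \<Rightarrow>\<^sub>0 'k) set" where
  "tnull V W = module.span fscale
     ((\<Union>y\<in>car W. slot_relations V (\<lambda>x. (x, y))) \<union> (\<Union>x\<in>car V. slot_relations W (\<lambda>y. (x, y))))"

definition tcls ::
  "('k::field, 'v::ab_group_add) vspace \<Rightarrow> ('k, 'w::ab_group_add) vspace \<Rightarrow>
     ('v \<times> 'w \<Rightarrow>\<^sub>0 'k) \<Rightarrow> ('v \<times> 'w \<Rightarrow>\<^sub>0 'k) set" where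
  "tcls V W p = {q. keys q \<subseteq> car V \<times> car W \<and> q - p \<in> tnull V W}"

definition tprod ::
  "('k::field, 'v::ab_group_add) vspace \<Rightarrow> ('k, 'w::ab_group_add) vspace \<Rightarrow>
     ('v \<times> 'w \<Rightarrow>\<^sub>0 'k) set set" where
  "tprod V W = tcls V W ` {p. keys p \<subseteq> car V \<times> car W}"

text \<open>The threefold tensor product \<open>U \<otimes> V \<otimes> W\<close>, without bracketing.\<close>

definition tnull3 ::
  "('k::field, 'u::ab_group_add) vspace \<Rightarrow> ('k, 'v::ab_group_add) vspace \<Rightarrow>
     ('k, 'w::ab_group_add) vspace \<Rightarrow> ('u \<times> 'v \<times> 'w \<Rightarrow>\<^sub>0 'k) set" where
  "tnull3 U V W = module.span fscale
     ((\<Union>y\<in>car V. \<Union>z\<in>car W. slot_relations U (\<lambda>x. (x, y, z)))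
    \<union> (\<Union>x\<in>car U. \<Union>z\<in>car W. slot_relations V (\<lambda>y. (x, y, z)))
    \<union> (\<Union>x\<in>car U. \<Union>y\<in>car V. slot_relations W (\<lambda>z. (x, y, z))))"

definition tcls3 ::
  "('k::field, 'u::ab_group_add) vspace \<Rightarrow> ('k, 'v::ab_group_add) vspace \<Rightarrow>
     ('k, 'w::ab_group_add) vspace \<Rightarrow> ('u \<times> 'v \<times> 'w \<Rightarrow>\<^sub>0 'k) \<Rightarrow> ('u \<times> 'v \<times> 'w \<Rightarrow>\<^sub>0 'k) set" where
  "tcls3 U V W p = {q. keys q \<subseteq> car U \<times> car V \<times> car W \<and> q - p \<in> tnull3 U V W}"

text \<open>
  Maps out of a tensor product are evaluated on a representative of the coset; this is independent
  of the representative whenever the underlying map of pairs is bilinear, as it is at every use below.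
\<close>

definition trep :: "('i \<Rightarrow>\<^sub>0 'k::zero) set \<Rightarrow> ('i \<Rightarrow>\<^sub>0 'k)" where
  "trep X = (SOME p. p \<in> X)"

text \<open>The linear map on \<open>V \<otimes> W\<close> induced by a bilinear map \<open>f\<close> into a space with scaling \<open>s\<close>.\<close>

definition tlift ::
  "('k::field \<Rightarrow> 'u \<Rightarrow> 'u) \<Rightarrow> ('v \<Rightarrow> 'w \<Rightarrow> 'u) \<Rightarrow> ('v \<times> 'w \<Rightarrow>\<^sub>0 'k) set \<Rightarrow> 'u::ab_group_add" where
  "tlift s f X = linext s (\<lambda>(x, y). f x y) (trep X)"

text \<open>\<open>f \<otimes> g\<close> with values in \<open>V \<otimes> W\<close>.\<close>

definition tmap ::
  "('k::field, 'v::ab_group_add) vspace \<Rightarrow> ('k, 'w::ab_group_add) vspace \<Rightarrow>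
     ('x \<Rightarrow> 'v) \<Rightarrow> ('y \<Rightarrow> 'w) \<Rightarrow> ('x \<times> 'y \<Rightarrow>\<^sub>0 'k) set \<Rightarrow> ('v \<times> 'w \<Rightarrow>\<^sub>0 'k) set" where
  "tmap V W f g X = tcls V W (lin (\<lambda>(x, y). single (f x, g y) 1) (trep X))"

text \<open>\<open>\<delta> \<otimes> id\<close> and \<open>id \<otimes> \<delta>\<close> with values in \<open>U \<otimes> V \<otimes> W\<close>.\<close>

definition tmap_left ::
  "('k::field, 'u::ab_group_add) vspace \<Rightarrow> ('k, 'v::ab_group_add) vspace \<Rightarrow>
     ('k, 'w::ab_group_add) vspace \<Rightarrow> ('x \<Rightarrow> ('u \<times> 'v \<Rightarrow>\<^sub>0 'k) set) \<Rightarrow>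
     ('x \<times> 'w \<Rightarrow>\<^sub>0 'k) set \<Rightarrow> ('u \<times> 'v \<times> 'w \<Rightarrow>\<^sub>0 'k) set" where
  "tmap_left U V W \<delta> X =
     tcls3 U V W (lin (\<lambda>(x, z). lin (\<lambda>(u, v). single (u, v, z) 1) (trep (\<delta> x))) (trep X))"

definition tmap_right ::
  "('k::field, 'u::ab_group_add) vspace \<Rightarrow> ('k, 'v::ab_group_add) vspace \<Rightarrow>
     ('k, 'w::ab_group_add) vspace \<Rightarrow> ('x \<Rightarrow> ('v \<times> 'w \<Rightarrow>\<^sub>0 'k) set) \<Rightarrow>
     ('u \<times> 'x \<Rightarrow>\<^sub>0 'k) set \<Rightarrow> ('u \<times> 'v \<times> 'w \<Rightarrow>\<^sub>0 'k) set" where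
  "tmap_right U V W \<delta> X =
     tcls3 U V W (lin (\<lambda>(u, x). lin (\<lambda>(v, w). single (u, v, w) 1) (trep (\<delta> x))) (trep X))"

definition tadd ::
  "('k::field, 'v::ab_group_add) vspace \<Rightarrow> ('k, 'w::ab_group_add) vspace \<Rightarrow>
     ('v \<times> 'w \<Rightarrow>\<^sub>0 'k) set \<Rightarrow> ('v \<times> 'w \<Rightarrow>\<^sub>0 'k) set \<Rightarrow> ('v \<times> 'w \<Rightarrow>\<^sub>0 'k) set" where
  "tadd V W X Y = tcls V W (trep X + trep Y)"

definition tscale ::
  "('k::field, 'v::ab_group_add) vspace \<Rightarrow> ('k, 'w::ab_group_add) vspace \<Rightarrow>
     'k \<Rightarrow> ('v \<times> 'w \<Rightarrow>\<^sub>0 'k) set \<Rightarrow> ('v \<times> 'w \<Rightarrow>\<^sub>0 'k) set" where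
  "tscale V W c X = tcls V W (fscale c (trep X))"

text \<open>The product \<open>(x \<otimes> y) (x' \<otimes> y') = x x' \<otimes> y y'\<close>, on formal combinations and on cosets.\<close>

definition fmult ::
  "('a::times \<times> 'b::times \<Rightarrow>\<^sub>0 'k::field) \<Rightarrow> ('a \<times> 'b \<Rightarrow>\<^sub>0 'k) \<Rightarrow> ('a \<times> 'b \<Rightarrow>\<^sub>0 'k)" where
  "fmult p q = lin (\<lambda>(x, y). lin (\<lambda>(x', y'). single (x * x', y * y') 1) q) p"

definition tmult ::
  "('k::field, 'a::ring_1) vspace \<Rightarrow> ('k, 'b::ring_1) vspace \<Rightarrow>
     ('a \<times> 'b \<Rightarrow>\<^sub>0 'k) set \<Rightarrow> ('a \<times> 'b \<Rightarrow>\<^sub>0 'k) set \<Rightarrow> ('a \<times> 'b \<Rightarrow>\<^sub>0 'k) set" where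
  "tmult V W X Y = tcls V W (fmult (trep X) (trep Y))"


section \<open>Hopf algebras\<close>

text \<open>The underlying ring of a Hopf algebra is the whole type \<^typ>\<open>'a\<close> of class \<^class>\<open>ring_1\<close>.\<close>

record (overloaded) ('k, 'a) hopf =
  hscale :: "'k::zero \<Rightarrow> 'a \<Rightarrow> 'a"
  comult :: "'a \<Rightarrow> ('a \<times> 'a \<Rightarrow>\<^sub>0 'k) set"
  counit :: "'a \<Rightarrow> 'k"
  antipode :: "'a \<Rightarrow> 'a"

abbreviation hvs :: "('k::field, 'a) hopf \<Rightarrow> ('k, 'a) vspace" where
  "hvs H \<equiv> \<lparr>car = UNIV, scl = hscale H\<rparr>"

locale hopf_algebra = vector_space "hscale H"
  for H :: "('k::field, 'a::ring_1) hopf" +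
  assumes scale_mult_left: "hscale H c (x * y) = hscale H c x * y"
    and scale_mult_right: "hscale H c (x * y) = x * hscale H c y"
    and comult_closed: "comult H x \<in> tprod (hvs H) (hvs H)"
    and comult_add: "comult H (x + y) = tadd (hvs H) (hvs H) (comult H x) (comult H y)"
    and comult_scale: "comult H (hscale H c x) = tscale (hvs H) (hvs H) c (comult H x)"
    and comult_one: "comult H 1 = tcls (hvs H) (hvs H) (single (1, 1) 1)"
    and comult_mult: "comult H (x * y) = tmult (hvs H) (hvs H) (comult H x) (comult H y)"
    and counit_add: "counit H (x + y) = counit H x + counit H y"
    and counit_scale: "counit H (hscale H c x) = c * counit H x"
    and counit_one: "counit H 1 = 1"
    and counit_mult: "counit H (x * y) = counit H x * counit H y"
    and coassoc: "tmap_left (hvs H) (hvs H) (hvs H) (comult H) (comult H x)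
                = tmap_right (hvs H) (hvs H) (hvs H) (comult H) (comult H x)"
    and counit_left: "tlift (hscale H) (\<lambda>u v. hscale H (counit H u) v) (comult H x) = x"
    and counit_right: "tlift (hscale H) (\<lambda>u v. hscale H (counit H v) u) (comult H x) = x"
    and antipode_add: "antipode H (x + y) = antipode H x + antipode H y"
    and antipode_scale: "antipode H (hscale H c x) = hscale H c (antipode H x)"
    and antipode_left: "tlift (hscale H) (\<lambda>u v. antipode H u * v) (comult H x) = hscale H (counit H x) 1"
    and antipode_right: "tlift (hscale H) (\<lambda>u v. u * antipode H v) (comult H x) = hscale H (counit H x) 1"

definition hopf_hom ::
  "('k::field, 'a::ring_1) hopf \<Rightarrow> ('k, 'b::ring_1) hopf \<Rightarrow> ('a \<Rightarrow> 'b) \<Rightarrow> bool" where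
  "hopf_hom H K f \<longleftrightarrow>
     Vector_Spaces.linear (hscale H) (hscale K) f
   \<and> f 1 = 1 \<and> (\<forall>x y. f (x * y) = f x * f y)
   \<and> (\<forall>x. comult K (f x) = tmap (hvs K) (hvs K) f f (comult H x))
   \<and> (\<forall>x. counit K (f x) = counit H x)
   \<and> (\<forall>x. antipode K (f x) = f (antipode H x))"

definition grouplikes :: "('k::field, 'a::ring_1) hopf \<Rightarrow> 'a set" where
  "grouplikes H = {x. comult H x = tcls (hvs H) (hvs H) (single (x, x) 1) \<and> counit H x = 1}"


section \<open>Comodules and pointedness\<close>

text \<open>Right comodules, with coaction \<open>\<rho>: V \<rightarrow> V \<otimes> H\<close>.\<close>

definition comodule ::
  "('k::field, 'a::ring_1) hopf \<Rightarrow> ('k, 'v::ab_group_add) vspace \<Rightarrow>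
     ('v \<Rightarrow> ('v \<times> 'a \<Rightarrow>\<^sub>0 'k) set) \<Rightarrow> bool" where
  "comodule H V \<rho> \<longleftrightarrow>
     is_vspace V
   \<and> (\<forall>v\<in>car V. \<rho> v \<in> tprod V (hvs H))
   \<and> (\<forall>v\<in>car V. \<forall>w\<in>car V. \<rho> (v + w) = tadd V (hvs H) (\<rho> v) (\<rho> w))
   \<and> (\<forall>c. \<forall>v\<in>car V. \<rho> (scl V c v) = tscale V (hvs H) c (\<rho> v))
   \<and> (\<forall>v\<in>car V. tmap_left V (hvs H) (hvs H) \<rho> (\<rho> v)
                = tmap_right V (hvs H) (hvs H) (comult H) (\<rho> v))
   \<and> (\<forall>v\<in>car V. tlift (scl V) (\<lambda>w x. scl V (counit H x) w) (\<rho> v) = v)"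

definition subcomodule ::
  "('k::field, 'a::ring_1) hopf \<Rightarrow> ('k, 'v::ab_group_add) vspace \<Rightarrow>
     ('v \<Rightarrow> ('v \<times> 'a \<Rightarrow>\<^sub>0 'k) set) \<Rightarrow> 'v set \<Rightarrow> bool" where
  "subcomodule H V \<rho> U \<longleftrightarrow>
     module.subspace (scl V) U \<and> U \<subseteq> car V
   \<and> (\<forall>u\<in>U. \<exists>p. keys p \<subseteq> U \<times> UNIV \<and> \<rho> u = tcls V (hvs H) p)"

definition simple_comodule ::
  "('k::field, 'a::ring_1) hopf \<Rightarrow> ('k, 'v::ab_group_add) vspace \<Rightarrow>
     ('v \<Rightarrow> ('v \<times> 'a \<Rightarrow>\<^sub>0 'k) set) \<Rightarrow> bool" where
  "simple_comodule H V \<rho> \<longleftrightarrow>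
     comodule H V \<rho> \<and> car V \<noteq> {0} \<and> (\<forall>U. subcomodule H V \<rho> U \<longrightarrow> U = {0} \<or> U = car V)"

text \<open>
  A definition cannot quantify over all types, so the comodules tested are those whose underlying
  space is a subspace of \<open>H\<close>, with an arbitrary coaction.  This loses nothing: every
  simple comodule \<open>V\<close> is isomorphic to one of these, because for a nonzero linear form \<open>f\<close> on
  \<open>V\<close> the map \<open>(f \<otimes> id) \<rho>: V \<rightarrow> H\<close> is an injective map of comodules.
\<close>

definition pointed :: "('k::field, 'a::ring_1) hopf \<Rightarrow> bool" where
  "pointed H \<longleftrightarrow>
     (\<forall>V \<rho>. simple_comodule H \<lparr>car = V, scl = hscale H\<rparr> \<rho> \<longrightarrow> vector_space.dim (hscale H) V = 1)"


section \<open>Group algebras\<close>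

text \<open>
  The convolution product of \<^typ>\<open>'g \<Rightarrow>\<^sub>0 'k\<close> is the product of the group algebra.
  The class \<^class>\<open>group_add\<close> of arbitrary (not necessarily commutative) groups is written additively.
\<close>

definition group_hopf :: "('k::field, 'g::group_add \<Rightarrow>\<^sub>0 'k) hopf" where
  "group_hopf = \<lparr>
     hscale = fscale,
     comult = (\<lambda>p. tcls \<lparr>car = UNIV, scl = fscale\<rparr> \<lparr>car = UNIV, scl = fscale\<rparr>
                     (lin (\<lambda>g. single (single g 1, single g 1) 1) p)),
     counit = linext (*) (\<lambda>g. 1),
     antipode = lin (\<lambda>g. single (- g) 1)\<rparr>"


section \<open>Dense big cells\<close>

text \<open>\<open>\<psi>\<close> maps \<open>Gr(B)\<close> onto the basis \<open>\<Lambda>\<close> of \<open>k\<Lambda>\<close> by a group isomorphism.\<close>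

definition induces_group_iso ::
  "('k::field, 'b::ring_1) hopf \<Rightarrow> ('b \<Rightarrow> ('g::group_add \<Rightarrow>\<^sub>0 'k)) \<Rightarrow> bool" where
  "induces_group_iso B \<psi> \<longleftrightarrow>
     (\<exists>\<phi>. bij_betw \<phi> (grouplikes B) UNIV
        \<and> (\<forall>x\<in>grouplikes B. \<forall>y\<in>grouplikes B. \<phi> (x * y) = \<phi> x + \<phi> y)
        \<and> (\<forall>x\<in>grouplikes B. \<psi> x = single (\<phi> x) 1))"

definition dense_big_cell ::
  "('k::field, 'h::ring_1) hopf \<Rightarrow> ('k, 'b::ring_1) hopf \<Rightarrow> ('k, 'c::ring_1) hopf \<Rightarrow>
     ('h \<Rightarrow> 'b) \<Rightarrow> ('b \<Rightarrow> ('g::group_add \<Rightarrow>\<^sub>0 'k)) \<Rightarrow>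
     ('h \<Rightarrow> 'c) \<Rightarrow> ('c \<Rightarrow> ('g \<Rightarrow>\<^sub>0 'k)) \<Rightarrow> bool" where
  "dense_big_cell H B B' \<pi> \<psi> \<pi>' \<psi>' \<longleftrightarrow>
     hopf_algebra B \<and> pointed B \<and> hopf_algebra B' \<and> pointed B'
   \<and> hopf_hom H B \<pi> \<and> surj \<pi> \<and> hopf_hom B group_hopf \<psi> \<and> surj \<psi>
   \<and> hopf_hom H B' \<pi>' \<and> surj \<pi>' \<and> hopf_hom B' group_hopf \<psi>' \<and> surj \<psi>'
   \<and> \<psi> \<circ> \<pi> = \<psi>' \<circ> \<pi>' \<and> induces_group_iso B \<psi> \<and> induces_group_iso B' \<psi>'
   \<and> inj (\<lambda>x. tmap (hvs B) (hvs B') \<pi> \<pi>' (comult H x))"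


section \<open>Free algebras\<close>

text \<open>
  Words with concatenation as addition, so that \<open>'x word \<Rightarrow>\<^sub>0 'k\<close> is the free algebra on \<open>'x\<close>.
\<close>

datatype 'x word = Word (letters: "'x list")

instantiation word :: (type) monoid_add
begin

definition "0 = Word []"
definition "u + v = Word (letters u @ letters v)"

instance by standard (simp_all add: zero_word_def plus_word_def)

end

abbreviation var :: "'x \<Rightarrow> ('x word \<Rightarrow>\<^sub>0 'k::field)" where
  "var x \<equiv> single (Word [x]) 1"

inductive_set two_sided_ideal :: "'r::ring_1 set \<Rightarrow> 'r set" for R where
  zero: "0 \<in> two_sided_ideal R"
| gen: "r \<in> R \<Longrightarrow> r \<in> two_sided_ideal R"
| add: "r \<in> two_sided_ideal R \<Longrightarrow> r' \<in> two_sided_ideal R \<Longrightarrow> r + r' \<in> two_sided_ideal R"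
| mult_left: "r \<in> two_sided_ideal R \<Longrightarrow> x * r \<in> two_sided_ideal R"
| mult_right: "r \<in> two_sided_ideal R \<Longrightarrow> r * x \<in> two_sided_ideal R"


section \<open>The Jordanian quantum SL(2)\<close>

datatype gen = Ga | Gb | Gc | Gd

definition sl2j_relators :: "(gen word \<Rightarrow>\<^sub>0 'k::field) set" where
  "sl2j_relators = (let a = var Ga; b = var Gb; c = var Gc; d = var Gd in
     {(c * a - a * c) - c * c,
      c * c - (c * d - d * c),
      (b * a - a * b) - (1 - a * a),
      (b * d - d * b) - (1 - d * d),
      (a * d - d * a) - (a * c - d * c),
      (c * b - b * c) - (a * c + c * d),
      1 - (a * d - b * c - a * c)})"

lemma lookup_fscale [simp]: "lookup (fscale c p) i = c * lookup p i"
  unfolding fscale_def by (transfer, simp add: when_def)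

lemma fscale_eq_mult: "fscale c p = single 0 c * p"
  by (simp add: fscale_def mult_map_scale_conv_mult)

global_interpretation fscale: vector_space fscale
  by standard (auto intro!: poly_mapping_eqI simp: lookup_add algebra_simps)

lemma fscale_single [simp]: "fscale c (single i a) = single i (c * a)"
  by (rule poly_mapping_eqI) (simp add: lookup_single when_def)

lemma sum_single: "(\<Sum>i\<in>keys p. single i (lookup p i)) = p"
  by (rule poly_mapping_eqI)
     (auto simp: lookup_sum lookup_single when_def in_keys_iff if_distrib cong: if_cong)

context vector_space
begin

lemma linext_superset:
  assumes "finite S" "keys p \<subseteq> S"
  shows "linext scale f p = (\<Sum>i\<in>S. scale (lookup p i) (f i))"
  unfolding linext_def using assms
  by (intro sum.mono_neutral_left) (auto simp: in_keys_iff)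

lemma linext_zero [simp]: "linext scale f 0 = 0"
  by (simp add: linext_def)

lemma linext_single [simp]: "linext scale f (single i c) = scale c (f i)"
  by (simp add: linext_def)

lemma linext_one: "linext scale f 1 = f 0"
  by (simp add: single_one [symmetric] del: single_one)

lemma linext_add: "linext scale f (p + q) = linext scale f p + linext scale f q"
proof -
  let ?S = "keys p \<union> keys q"
  have "keys (p + q) \<subseteq> ?S" by (rule Poly_Mapping.keys_add)
  then show ?thesis
    by (simp add: linext_superset [of ?S] lookup_add scale_left_distrib sum.distrib)
qed

lemma linext_fscale: "linext scale f (fscale c p) = scale c (linext scale f p)"
proof -
  have "keys (fscale c p) \<subseteq> keys p" by (auto simp: in_keys_iff)
  then show ?thesis
    by (simp add: linext_superset [of "keys p"] scale_sum_right)
qed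

lemma linext_linear: "Vector_Spaces.linear fscale scale (linext scale f)"
  by unfold_locales (simp_all add: linext_add linext_fscale)

lemma linext_uminus: "linext scale f (- p) = - linext scale f p"
  using linext_fscale [of f "- 1" p] by simp

lemma linext_diff: "linext scale f (p - q) = linext scale f p - linext scale f q"
  using linext_add [of f p "- q"] by (simp add: linext_uminus)

lemma linext_sum: "linext scale f (\<Sum>i\<in>I. g i) = (\<Sum>i\<in>I. linext scale f (g i))"
  by (induction I rule: infinite_finite_induct) (simp_all add: linext_add)

lemma linext_fun_add: "linext scale (\<lambda>i. f i + g i) p = linext scale f p + linext scale g p"
  by (simp add: linext_def scale_right_distrib sum.distrib)

lemma linext_fun_scale: "linext scale (\<lambda>i. scale c (f i)) p = scale c (linext scale f p)"
  by (simp add: linext_def scale_sum_right mult.commute)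

lemma linext_fun_zero: "linext scale (\<lambda>i. 0) p = 0"
  by (simp add: linext_def)

lemma linext_lin: "linext scale f (lin g p) = linext scale (\<lambda>i. linext scale f (g i)) p"
  by (simp add: linext_def [of fscale] linext_sum linext_fscale) (simp add: linext_def)

lemma linext_swap:
  "linext scale (\<lambda>i. linext scale (\<lambda>j. f i j) q) p = linext scale (\<lambda>j. linext scale (\<lambda>i. f i j) p) q"
  by (simp add: linext_def scale_sum_right sum.swap [of _ "keys q"] mult.commute)

lemma linext_times:
  fixes p q :: "'i::monoid_add \<Rightarrow>\<^sub>0 'a"
  shows "linext scale f (p * q) = linext scale (\<lambda>u. linext scale (\<lambda>v. f (u + v)) q) p"
proof -
  have "p * q = (\<Sum>u\<in>keys p. \<Sum>v\<in>keys q. single (u + v) (lookup p u * lookup q v))"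
    by (subst sum_single [of p, symmetric], subst sum_single [of q, symmetric])
       (simp add: sum_product mult_single)
  then show ?thesis
    by (simp add: linext_sum) (simp add: linext_def scale_sum_right)
qed

lemma linear_linext:
  assumes "Vector_Spaces.linear scale s' T"
  shows "T (linext scale f p) = linext s' (\<lambda>i. T (f i)) p"
proof -
  interpret T: Vector_Spaces.linear scale s' T by fact
  show ?thesis by (simp add: linext_def T.sum T.scale)
qed

end

lemma linext_cong: "(\<And>i. f i = g i) \<Longrightarrow> linext s f p = linext s g p"
  by (simp add: linext_def)

lemma vector_space_times: "vector_space ((*) :: 'k::field \<Rightarrow> 'k \<Rightarrow> 'k)"
  by standard (auto simp: algebra_simps)

lemmas kext_one = vector_space.linext_one [OF vector_space_times]
  and kext_superset = vector_space.linext_superset [OF vector_space_times]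
  and kext_zero = vector_space.linext_zero [OF vector_space_times]
  and kext_single = vector_space.linext_single [OF vector_space_times]
  and kext_add = vector_space.linext_add [OF vector_space_times]
  and kext_fscale = vector_space.linext_fscale [OF vector_space_times]
  and kext_linear = vector_space.linext_linear [OF vector_space_times]
  and kext_uminus = vector_space.linext_uminus [OF vector_space_times]
  and kext_diff = vector_space.linext_diff [OF vector_space_times]
  and kext_sum = vector_space.linext_sum [OF vector_space_times]
  and kext_fun_add = vector_space.linext_fun_add [OF vector_space_times]
  and kext_fun_scale = vector_space.linext_fun_scale [OF vector_space_times]
  and kext_fun_zero = vector_space.linext_fun_zero [OF vector_space_times]
  and kext_lin = vector_space.linext_lin [OF vector_space_times]
  and kext_swap = vector_space.linext_swap [OF vector_space_times]
  and kext_times = vector_space.linext_times [OF vector_space_times]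


lemma two_sided_ideal_uminus:
  fixes R :: "'r::ring_1 set"
  assumes "r \<in> two_sided_ideal R"
  shows "- r \<in> two_sided_ideal R"
  using two_sided_ideal.mult_left [OF assms, of "- 1"] by simp

lemma two_sided_ideal_diff:
  fixes R :: "'r::ring_1 set"
  assumes "r \<in> two_sided_ideal R" "r' \<in> two_sided_ideal R"
  shows "r - r' \<in> two_sided_ideal R"
  using two_sided_ideal.add [OF assms(1) two_sided_ideal_uminus [OF assms(2)]] by simp

text \<open>
  \<open>'k sl2j\<close> is the algebra presented by the generators \<open>a, b, c, d\<close> and the relators above.
\<close>

quotient_type (overloaded) 'k sl2j = "gen word \<Rightarrow>\<^sub>0 'k::field" /
    "\<lambda>p q. p - q \<in> two_sided_ideal sl2j_relators"
  morphisms rep_sl2j sl2j_of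
proof (rule equivpI)
  show "reflp (\<lambda>p q::gen word \<Rightarrow>\<^sub>0 'k. p - q \<in> two_sided_ideal sl2j_relators)"
    by (rule reflpI) (simp add: two_sided_ideal.zero)
  show "symp (\<lambda>p q::gen word \<Rightarrow>\<^sub>0 'k. p - q \<in> two_sided_ideal sl2j_relators)"
  proof (rule sympI)
    fix p q :: "gen word \<Rightarrow>\<^sub>0 'k"
    assume "p - q \<in> two_sided_ideal sl2j_relators"
    then have "- (p - q) \<in> two_sided_ideal sl2j_relators" by (rule two_sided_ideal_uminus)
    then show "q - p \<in> two_sided_ideal sl2j_relators" by simp
  qed
  show "transp (\<lambda>p q::gen word \<Rightarrow>\<^sub>0 'k. p - q \<in> two_sided_ideal sl2j_relators)"
  proof (rule transpI)
    fix p q r :: "gen word \<Rightarrow>\<^sub>0 'k"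
    assume "p - q \<in> two_sided_ideal sl2j_relators" "q - r \<in> two_sided_ideal sl2j_relators"
    then have "(p - q) + (q - r) \<in> two_sided_ideal sl2j_relators" by (rule two_sided_ideal.add)
    then show "p - r \<in> two_sided_ideal sl2j_relators" by simp
  qed
qed

definition counit_gen :: "gen \<Rightarrow> 'k::field" where
  "counit_gen g = (case g of Ga \<Rightarrow> 1 | Gb \<Rightarrow> 0 | Gc \<Rightarrow> 0 | Gd \<Rightarrow> 1)"

definition counit_word :: "gen list \<Rightarrow> 'k::field" where
  "counit_word gs = prod_list (map counit_gen gs)"

lemma counit_word_append: "counit_word (gs @ hs) = counit_word gs * counit_word hs"
  by (simp add: counit_word_def)

lemma linext_counit_times:
  "linext (*) (\<lambda>w. counit_word (letters w)) (p * q) =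
   linext (*) (\<lambda>w. counit_word (letters w)) p * linext (*) (\<lambda>w. counit_word (letters w)) q"
  (is "?E (p * q) = _")
proof -
  have "?E (p * q) = linext (*) (\<lambda>u. linext (*) (\<lambda>v. counit_word (letters u) * counit_word (letters v)) q) p"
    by (simp only: kext_times plus_word_def word.sel counit_word_append)
  also have "\<dots> = linext (*) (\<lambda>u. counit_word (letters u) * ?E q) p"
    by (simp only: kext_fun_scale)
  also have "\<dots> = ?E p * ?E q"
    by (simp add: linext_def sum_distrib_right mult.assoc)
  finally show ?thesis .
qed

lemma linext_counit_ideal:
  assumes "p \<in> two_sided_ideal sl2j_relators"
  shows "linext (*) (\<lambda>w. counit_word (letters w)) p = (0::'k::field)"
  using assms
proof induction
  case (gen r)
  then show ?case
    by (auto simp: sl2j_relators_def Let_def mult_single plus_word_def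
          kext_single kext_add kext_diff counit_word_def counit_gen_def
          kext_one zero_word_def)
qed (simp_all add: kext_zero kext_add linext_counit_times)

instantiation sl2j :: (field) ring_1
begin

lift_definition zero_sl2j :: "'a sl2j" is 0 .
lift_definition one_sl2j :: "'a sl2j" is 1 .

lift_definition plus_sl2j :: "'a sl2j \<Rightarrow> 'a sl2j \<Rightarrow> 'a sl2j" is "(+)"
proof -
  fix p p' q q' :: "gen word \<Rightarrow>\<^sub>0 'a"
  assume "p - p' \<in> two_sided_ideal sl2j_relators" "q - q' \<in> two_sided_ideal sl2j_relators"
  then have "(p - p') + (q - q') \<in> two_sided_ideal sl2j_relators"
    by (rule two_sided_ideal.add)
  then show "p + q - (p' + q') \<in> two_sided_ideal sl2j_relators"
    by (simp add: algebra_simps)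
qed

lift_definition uminus_sl2j :: "'a sl2j \<Rightarrow> 'a sl2j" is uminus
proof -
  fix p p' :: "gen word \<Rightarrow>\<^sub>0 'a"
  assume "p - p' \<in> two_sided_ideal sl2j_relators"
  then have "- (p - p') \<in> two_sided_ideal sl2j_relators"
    by (rule two_sided_ideal_uminus)
  then show "- p - - p' \<in> two_sided_ideal sl2j_relators"
    by simp
qed

lift_definition minus_sl2j :: "'a sl2j \<Rightarrow> 'a sl2j \<Rightarrow> 'a sl2j" is "(-)"
proof -
  fix p p' q q' :: "gen word \<Rightarrow>\<^sub>0 'a"
  assume "p - p' \<in> two_sided_ideal sl2j_relators" "q - q' \<in> two_sided_ideal sl2j_relators"
  then have "(p - p') - (q - q') \<in> two_sided_ideal sl2j_relators"
    by (rule two_sided_ideal_diff)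
  then show "p - q - (p' - q') \<in> two_sided_ideal sl2j_relators"
    by (simp add: algebra_simps)
qed

lift_definition times_sl2j :: "'a sl2j \<Rightarrow> 'a sl2j \<Rightarrow> 'a sl2j" is "(*)"
proof -
  fix p p' q q' :: "gen word \<Rightarrow>\<^sub>0 'a"
  assume "p - p' \<in> two_sided_ideal sl2j_relators" "q - q' \<in> two_sided_ideal sl2j_relators"
  then have "(p - p') * q + p' * (q - q') \<in> two_sided_ideal sl2j_relators"
    by (intro two_sided_ideal.add two_sided_ideal.mult_left two_sided_ideal.mult_right)
  then show "p * q - p' * q' \<in> two_sided_ideal sl2j_relators"
    by (simp add: algebra_simps)
qed

instance
proof
  fix x y z :: "'a sl2j"
  show "x + y + z = x + (y + z)" by transfer (simp add: add.assoc two_sided_ideal.zero)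
  show "x + y = y + x" by transfer (simp add: add.commute two_sided_ideal.zero)
  show "0 + x = x" by transfer (simp add: two_sided_ideal.zero)
  show "- x + x = 0" by transfer (simp add: two_sided_ideal.zero)
  show "x - y = x + - y" by transfer (simp add: two_sided_ideal.zero)
  show "x * y * z = x * (y * z)" by transfer (simp add: mult.assoc two_sided_ideal.zero)
  show "1 * x = x" by transfer (simp add: two_sided_ideal.zero)
  show "x * 1 = x" by transfer (simp add: two_sided_ideal.zero)
  show "(x + y) * z = x * z + y * z"
    by transfer (simp add: distrib_right two_sided_ideal.zero)
  show "x * (y + z) = x * y + x * z"
    by transfer (simp add: distrib_left two_sided_ideal.zero)
  show "(0::'a sl2j) \<noteq> 1"
  proof transfer
    have "linext (*) (\<lambda>w. counit_word (letters w)) (0 - 1 :: gen word \<Rightarrow>\<^sub>0 'a) = - 1"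
      by (simp add: kext_zero kext_one kext_uminus counit_word_def zero_word_def)
    then show "(0::gen word \<Rightarrow>\<^sub>0 'a) - 1 \<notin> two_sided_ideal sl2j_relators"
      using linext_counit_ideal [of "0 - 1 :: gen word \<Rightarrow>\<^sub>0 'a"] by auto
  qed
qed

end

lift_definition sl2j_scale :: "'k::field \<Rightarrow> 'k sl2j \<Rightarrow> 'k sl2j" is fscale
proof -
  fix c and p q :: "gen word \<Rightarrow>\<^sub>0 'k"
  assume "p - q \<in> two_sided_ideal sl2j_relators"
  then show "fscale c p - fscale c q \<in> two_sided_ideal sl2j_relators"
    by (simp add: fscale_eq_mult right_diff_distrib [symmetric] two_sided_ideal.mult_left)
qed

definition sl2j_gen :: "gen \<Rightarrow> 'k::field sl2j" where
  "sl2j_gen g = sl2j_of (var g)"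

text \<open>
  The structure maps on generators, and their (anti)multiplicative extension to words.
\<close>

definition comult_gen :: "gen \<Rightarrow> ('k::field sl2j \<times> 'k sl2j \<Rightarrow>\<^sub>0 'k)" where
  "comult_gen g = (let a = sl2j_gen Ga; b = sl2j_gen Gb; c = sl2j_gen Gc; d = sl2j_gen Gd in
     case g of
       Ga \<Rightarrow> single (a, a) 1 + single (b, c) 1
     | Gb \<Rightarrow> single (a, b) 1 + single (b, d) 1
     | Gc \<Rightarrow> single (c, a) 1 + single (d, c) 1
     | Gd \<Rightarrow> single (c, b) 1 + single (d, d) 1)"

fun comult_word :: "gen list \<Rightarrow> ('k::field sl2j \<times> 'k sl2j \<Rightarrow>\<^sub>0 'k)" where
  "comult_word [] = single (1, 1) 1"
| "comult_word (g # gs) = fmult (comult_gen g) (comult_word gs)"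

definition antipode_gen :: "gen \<Rightarrow> 'k::field sl2j" where
  "antipode_gen g = (let a = sl2j_gen Ga; b = sl2j_gen Gb; c = sl2j_gen Gc; d = sl2j_gen Gd in
     case g of Ga \<Rightarrow> d - c | Gb \<Rightarrow> a - b + c - d | Gc \<Rightarrow> - c | Gd \<Rightarrow> a + c)"

definition antipode_word :: "gen list \<Rightarrow> 'k::field sl2j" where
  "antipode_word gs = prod_list (rev (map antipode_gen gs))"

text \<open>
  Elements are evaluated on representatives in the free algebra; that the relators are respected
  is part of the proof of \<open>hopf_algebra sl2j\<close> below.
\<close>

definition sl2j :: "('k::field, 'k sl2j) hopf" where
  "sl2j = \<lparr>
     hscale = sl2j_scale,
     comult = (\<lambda>x. tcls \<lparr>car = UNIV, scl = sl2j_scale\<rparr> \<lparr>car = UNIV, scl = sl2j_scale\<rparr>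
                     (lin (\<lambda>w. comult_word (letters w)) (rep_sl2j x))),
     counit = (\<lambda>x. linext (*) (\<lambda>w. counit_word (letters w)) (rep_sl2j x)),
     antipode = (\<lambda>x. linext sl2j_scale (\<lambda>w. antipode_word (letters w)) (rep_sl2j x))\<rparr>"


section \<open>Tensor products and bilinear maps\<close>

definition bilin ::
  "('k::field \<Rightarrow> 'v \<Rightarrow> 'v) \<Rightarrow> ('k \<Rightarrow> 'w \<Rightarrow> 'w) \<Rightarrow> ('k \<Rightarrow> 'u \<Rightarrow> 'u) \<Rightarrow>
     ('v::ab_group_add \<Rightarrow> 'w::ab_group_add \<Rightarrow> 'u::ab_group_add) \<Rightarrow> bool" where
  "bilin s1 s2 s f \<longleftrightarrow>
     (\<forall>x x' y. f (x + x') y = f x y + f x' y) \<and> (\<forall>c x y. f (s1 c x) y = s c (f x y))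
   \<and> (\<forall>x y y'. f x (y + y') = f x y + f x y') \<and> (\<forall>c x y. f x (s2 c y) = s c (f x y))"

definition trilin ::
  "('k::field \<Rightarrow> 'v \<Rightarrow> 'v) \<Rightarrow> ('k \<Rightarrow> 'w \<Rightarrow> 'w) \<Rightarrow> ('k \<Rightarrow> 'x \<Rightarrow> 'x) \<Rightarrow> ('k \<Rightarrow> 'u \<Rightarrow> 'u) \<Rightarrow>
     ('v::ab_group_add \<Rightarrow> 'w::ab_group_add \<Rightarrow> 'x::ab_group_add \<Rightarrow> 'u::ab_group_add) \<Rightarrow> bool" where
  "trilin s1 s2 s3 s f \<longleftrightarrow>
     (\<forall>x. bilin s2 s3 s (f x)) \<and> (\<forall>y. bilin s1 s3 s (\<lambda>x. f x y)) \<and> (\<forall>z. bilin s1 s2 s (\<lambda>x y. f x y z))"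

lemma bilinD:
  assumes "bilin s1 s2 s f"
  shows "f (x + x') y = f x y + f x' y" "f (s1 c x) y = s c (f x y)"
    "f x (y + y') = f x y + f x y'" "f x (s2 c y) = s c (f x y)"
    "f 0 y = 0" "f x 0 = 0" "f (- x) y = - f x y" "f x (- y) = - f x y"
    "f (x - x') y = f x y - f x' y" "f x (y - y') = f x y - f x y'"
proof -
  have al: "\<And>x x' y. f (x + x') y = f x y + f x' y" and ar: "\<And>x y y'. f x (y + y') = f x y + f x y'"
    using assms by (auto simp: bilin_def)
  show "f (x + x') y = f x y + f x' y" "f x (y + y') = f x y + f x y'" by (fact al ar)+
  show "f (s1 c x) y = s c (f x y)" "f x (s2 c y) = s c (f x y)" using assms by (auto simp: bilin_def)
  interpret l: additive "\<lambda>x. f x y" for y by standard (rule al)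
  interpret r: additive "f x" for x by standard (rule ar)
  show "f 0 y = 0" "f x 0 = 0" "f (- x) y = - f x y" "f x (- y) = - f x y"
    "f (x - x') y = f x y - f x' y" "f x (y - y') = f x y - f x y'"
    by (fact l.zero r.zero l.minus r.minus l.diff r.diff)+
qed

lemma linear_form_separates:
  assumes "\<And>\<phi>. Vector_Spaces.linear fscale (*) \<phi> \<Longrightarrow> (\<And>r. r \<in> R \<Longrightarrow> \<phi> r = 0) \<Longrightarrow> \<phi> p = (0::'k::field)"
  shows "p \<in> fscale.span R"
proof (rule ccontr)
  assume p: "p \<notin> fscale.span R"
  interpret k: vector_space "(*) :: 'k \<Rightarrow> 'k \<Rightarrow> 'k" by (rule vector_space_times)
  interpret fk: vector_space_pair fscale "(*) :: 'k \<Rightarrow> 'k \<Rightarrow> 'k" ..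
  obtain B where B: "B \<subseteq> R" "fscale.independent B" "R \<subseteq> fscale.span B"
    using fscale.maximal_independent_subset by blast
  have "p \<notin> fscale.span B" using p B(1) fscale.span_mono by blast
  then have ind: "fscale.independent (insert p B)"
    using B(2) by (simp add: fscale.independent_insert)
  obtain \<phi> where \<phi>: "Vector_Spaces.linear fscale (*) \<phi>"
      "\<forall>x\<in>insert p B. \<phi> x = (if x = p then 1 else 0)"
    using fk.linear_independent_extend [OF ind, of "\<lambda>x. if x = p then 1 else 0"] by blast
  interpret \<phi>: Vector_Spaces.linear fscale "(*)" \<phi> by (fact \<phi>(1))
  have "p \<notin> B" using \<open>p \<notin> fscale.span B\<close> fscale.span_base by blast
  have "\<phi> b = 0" if "b \<in> B" for b
    using that \<phi>(2) \<open>p \<notin> B\<close> by auto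
  then have "\<phi> r = 0" if "r \<in> R" for r
    using that B(3) \<phi>.eq_0_on_span [of B r] by blast
  then have "\<phi> p = 0" using assms \<phi>(1) by blast
  then show False using \<phi>(2) by simp
qed

lemma linear_form_linext:
  assumes "Vector_Spaces.linear fscale (*) \<phi>"
  shows "\<phi> p = linext (*) (\<lambda>i. \<phi> (single i 1)) (p :: 'i \<Rightarrow>\<^sub>0 'k::field)"
proof -
  interpret \<phi>: Vector_Spaces.linear fscale "(*)" \<phi> by fact
  have "lin (\<lambda>i. single i 1) p = p"
    by (rule poly_mapping_eqI)
       (auto simp: linext_def lookup_sum lookup_single when_def in_keys_iff if_distrib cong: if_cong)
  then show ?thesis
    using fscale.linear_linext [OF assms, of "\<lambda>i. single i 1" p] by simp
qed

abbreviation uvs :: "('k \<Rightarrow> 'v \<Rightarrow> 'v) \<Rightarrow> ('k, 'v) vspace" where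
  "uvs s \<equiv> \<lparr>car = UNIV, scl = s\<rparr>"

lemma slot_relations_uvs_E:
  assumes "r \<in> slot_relations (uvs s) e"
  obtains (add) x y where "r = single (e (x + y)) 1 - single (e x) 1 - single (e y) 1"
  | (scale) c x where "r = single (e (s c x)) 1 - single (e x) c"
  using assms by (auto simp: slot_relations_def)

lemma slot_relations_uvs_I:
  "single (e (x + y)) 1 - single (e x) 1 - single (e y) 1 \<in> slot_relations (uvs s) e"
  "single (e (s c x)) 1 - single (e x) c \<in> slot_relations (uvs s) e"
  by (auto simp: slot_relations_def)

lemma slot_relations_form:
  assumes "Vector_Spaces.linear fscale (*) \<phi>" "\<And>r. r \<in> slot_relations (uvs s) e \<Longrightarrow> \<phi> r = (0::'k::field)"
  shows "\<phi> (single (e (x + y)) 1) = \<phi> (single (e x) 1) + \<phi> (single (e y) 1)"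
    "\<phi> (single (e (s c x)) 1) = c * \<phi> (single (e x) 1)"
proof -
  interpret \<phi>: Vector_Spaces.linear fscale "(*)" \<phi> by fact
  show "\<phi> (single (e (x + y)) 1) = \<phi> (single (e x) 1) + \<phi> (single (e y) 1)"
    using assms(2) [OF slot_relations_uvs_I(1) [of e x y]] unfolding \<phi>.diff by (simp add: algebra_simps)
  have "\<phi> (single (e x) c) = c * \<phi> (single (e x) 1)"
    using \<phi>.scale [of c "single (e x) 1"] by simp
  then show "\<phi> (single (e (s c x)) 1) = c * \<phi> (single (e x) 1)"
    using assms(2) [OF slot_relations_uvs_I(2) [of e s c x]] by (simp add: \<phi>.diff)
qed

lemma (in vector_space) linext_tnull:
  assumes "bilin s1 s2 scale f" "p \<in> tnull (uvs s1) (uvs s2)"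
  shows "linext scale (\<lambda>(x, y). f x y) p = 0"
proof -
  interpret L: Vector_Spaces.linear fscale scale "linext scale (\<lambda>(x, y). f x y)"
    by (rule linext_linear)
  note b = bilinD [OF assms(1)]
  show ?thesis
    by (rule L.eq_0_on_span [OF _ assms(2) [unfolded tnull_def]])
       (auto elim!: slot_relations_uvs_E simp: linext_diff b)
qed

lemma (in vector_space) linext_tnull3:
  assumes "trilin s1 s2 s3 scale f" "p \<in> tnull3 (uvs s1) (uvs s2) (uvs s3)"
  shows "linext scale (\<lambda>(x, y, z). f x y z) p = 0"
proof -
  interpret L: Vector_Spaces.linear fscale scale "linext scale (\<lambda>(x, y, z). f x y z)"
    by (rule linext_linear)
  have "\<And>x. bilin s2 s3 scale (f x)" "\<And>y. bilin s1 s3 scale (\<lambda>x. f x y)"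
    using assms(1) by (auto simp: trilin_def)
  note b = bilinD [OF this(1)] bilinD [OF this(2)]
  show ?thesis
    by (rule L.eq_0_on_span [OF _ assms(2) [unfolded tnull3_def]])
       (auto elim!: slot_relations_uvs_E simp: linext_diff b)
qed

lemma tnullI:
  fixes p :: "'v::ab_group_add \<times> 'w::ab_group_add \<Rightarrow>\<^sub>0 'k::field"
  assumes "\<And>f. bilin s1 s2 (*) f \<Longrightarrow> linext (*) (\<lambda>(x, y). f x y) p = 0"
  shows "p \<in> tnull (uvs s1) (uvs s2)"
  unfolding tnull_def
proof (rule linear_form_separates)
  fix \<phi> :: "('v \<times> 'w \<Rightarrow>\<^sub>0 'k) \<Rightarrow> 'k"
  assume \<phi>: "Vector_Spaces.linear fscale (*) \<phi>"
    and 0: "\<And>r. r \<in> (\<Union>y\<in>car (uvs s2). slot_relations (uvs s1) (\<lambda>x. (x, y)))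
              \<union> (\<Union>x\<in>car (uvs s1). slot_relations (uvs s2) (\<lambda>y. (x, y))) \<Longrightarrow> \<phi> r = 0"
  have "\<phi> r = 0" if "r \<in> slot_relations (uvs s1) (\<lambda>x. (x, y))" for r y
    by (rule 0) (use that in simp, blast)
  note l = slot_relations_form [OF \<phi>, where s = s1 and e = "\<lambda>x. (x, y)" for y, OF this, simplified]
  have "\<phi> r = 0" if "r \<in> slot_relations (uvs s2) (\<lambda>y. (x, y))" for r x
    by (rule 0) (use that in simp, blast)
  note r = slot_relations_form [OF \<phi>, where s = s2 and e = "\<lambda>y. (x, y)" for x, OF this, simplified]
  have "bilin s1 s2 (*) (\<lambda>x y. \<phi> (single (x, y) 1))"
    by (simp add: bilin_def l r)
  from assms [OF this] show "\<phi> p = 0"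
    by (subst linear_form_linext [OF \<phi>]) (simp add: case_prod_unfold)
qed

lemma tnull3I:
  fixes p :: "'v::ab_group_add \<times> 'w::ab_group_add \<times> 'x::ab_group_add \<Rightarrow>\<^sub>0 'k::field"
  assumes "\<And>f. trilin s1 s2 s3 (*) f \<Longrightarrow> linext (*) (\<lambda>(x, y, z). f x y z) p = 0"
  shows "p \<in> tnull3 (uvs s1) (uvs s2) (uvs s3)"
  unfolding tnull3_def
proof (rule linear_form_separates)
  fix \<phi> :: "('v \<times> 'w \<times> 'x \<Rightarrow>\<^sub>0 'k) \<Rightarrow> 'k"
  assume \<phi>: "Vector_Spaces.linear fscale (*) \<phi>"
    and 0: "\<And>r. r \<in> (\<Union>y\<in>car (uvs s2). \<Union>z\<in>car (uvs s3). slot_relations (uvs s1) (\<lambda>x. (x, y, z)))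
              \<union> (\<Union>x\<in>car (uvs s1). \<Union>z\<in>car (uvs s3). slot_relations (uvs s2) (\<lambda>y. (x, y, z)))
              \<union> (\<Union>x\<in>car (uvs s1). \<Union>y\<in>car (uvs s2). slot_relations (uvs s3) (\<lambda>z. (x, y, z)))
              \<Longrightarrow> \<phi> r = 0"
  have "\<phi> r = 0" if "r \<in> slot_relations (uvs s1) (\<lambda>x. (x, y, z))" for r y z
    by (rule 0) (use that in simp, blast)
  note 1 = slot_relations_form [OF \<phi>, where s = s1 and e = "\<lambda>x. (x, y, z)" for y z, OF this, simplified]
  have "\<phi> r = 0" if "r \<in> slot_relations (uvs s2) (\<lambda>y. (x, y, z))" for r x z
    by (rule 0) (use that in simp, blast)
  note 2 = slot_relations_form [OF \<phi>, where s = s2 and e = "\<lambda>y. (x, y, z)" for x z, OF this, simplified]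
  have "\<phi> r = 0" if "r \<in> slot_relations (uvs s3) (\<lambda>z. (x, y, z))" for r x y
    by (rule 0) (use that in simp, blast)
  note 3 = slot_relations_form [OF \<phi>, where s = s3 and e = "\<lambda>z. (x, y, z)" for x y, OF this, simplified]
  have "trilin s1 s2 s3 (*) (\<lambda>x y z. \<phi> (single (x, y, z) 1))"
    by (simp add: trilin_def bilin_def 1 2 3)
  from assms [OF this] show "\<phi> p = 0"
    by (subst linear_form_linext [OF \<phi>]) (simp add: case_prod_unfold)
qed

lemma tcls_eq:
  "tcls (uvs s1) (uvs s2) p = tcls (uvs s1) (uvs s2) q" if "p - q \<in> tnull (uvs s1) (uvs s2)"
proof -
  have "r - p \<in> tnull (uvs s1) (uvs s2) \<longleftrightarrow> r - q \<in> tnull (uvs s1) (uvs s2)" for r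
    using fscale.span_add_eq [OF that [unfolded tnull_def], of "r - p"]
    by (simp add: tnull_def add.commute)
  then show ?thesis by (auto simp: tcls_def)
qed

lemma tcls3_eq:
  "tcls3 (uvs s1) (uvs s2) (uvs s3) p = tcls3 (uvs s1) (uvs s2) (uvs s3) q"
  if "p - q \<in> tnull3 (uvs s1) (uvs s2) (uvs s3)"
proof -
  have "r - p \<in> tnull3 (uvs s1) (uvs s2) (uvs s3) \<longleftrightarrow> r - q \<in> tnull3 (uvs s1) (uvs s2) (uvs s3)" for r
    using fscale.span_add_eq [OF that [unfolded tnull3_def], of "r - p"]
    by (simp add: tnull3_def add.commute)
  then show ?thesis by (auto simp: tcls3_def)
qed

lemma tcls_eqI:
  fixes p q :: "'v::ab_group_add \<times> 'w::ab_group_add \<Rightarrow>\<^sub>0 'k::field"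
  assumes "\<And>f. bilin s1 s2 (*) f \<Longrightarrow> linext (*) (\<lambda>(x, y). f x y) p = linext (*) (\<lambda>(x, y). f x y) q"
  shows "tcls (uvs s1) (uvs s2) p = tcls (uvs s1) (uvs s2) q"
  by (intro tcls_eq tnullI) (simp add: kext_diff assms)

lemma tcls3_eqI:
  fixes p q :: "'v::ab_group_add \<times> 'w::ab_group_add \<times> 'x::ab_group_add \<Rightarrow>\<^sub>0 'k::field"
  assumes "\<And>f. trilin s1 s2 s3 (*) f \<Longrightarrow>
    linext (*) (\<lambda>(x, y, z). f x y z) p = linext (*) (\<lambda>(x, y, z). f x y z) q"
  shows "tcls3 (uvs s1) (uvs s2) (uvs s3) p = tcls3 (uvs s1) (uvs s2) (uvs s3) q"
  by (intro tcls3_eq tnull3I) (simp add: kext_diff assms)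

lemma trep_tcls: "trep (tcls (uvs s1) (uvs s2) p) - p \<in> tnull (uvs s1) (uvs s2)"
proof -
  have "p \<in> tcls (uvs s1) (uvs s2) p"
    by (simp add: tcls_def tnull_def fscale.span_zero)
  then have "trep (tcls (uvs s1) (uvs s2) p) \<in> tcls (uvs s1) (uvs s2) p"
    unfolding trep_def by (rule someI)
  then show ?thesis by (simp add: tcls_def)
qed

lemma (in vector_space) tlift_tcls:
  assumes "bilin s1 s2 scale f"
  shows "tlift scale f (tcls (uvs s1) (uvs s2) p) = linext scale (\<lambda>(x, y). f x y) p"
  using linext_tnull [OF assms trep_tcls] by (simp add: tlift_def linext_diff)

lemma (in vector_space) linext_fmult:
  "linext scale (\<lambda>(x, y). f x y) (fmult p q) =
   linext scale (\<lambda>(x, y). linext scale (\<lambda>(x', y'). f (x * x') (y * y')) q) p"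
  by (simp add: fmult_def linext_lin case_prod_unfold)


section \<open>The Hopf algebra structure of \<open>sl2j\<close>\<close>

lemma sl2j_of_zero: "sl2j_of 0 = 0" by (simp add: zero_sl2j.abs_eq)
lemma sl2j_of_one: "sl2j_of 1 = 1" by (simp add: one_sl2j.abs_eq)
lemma sl2j_of_add: "sl2j_of (p + q) = sl2j_of p + sl2j_of q" by (simp add: plus_sl2j.abs_eq)
lemma sl2j_of_diff: "sl2j_of (p - q) = sl2j_of p - sl2j_of q" by (simp add: minus_sl2j.abs_eq)
lemma sl2j_of_mult: "sl2j_of (p * q) = sl2j_of p * sl2j_of q" by (simp add: times_sl2j.abs_eq)
lemma sl2j_of_fscale: "sl2j_of (fscale c p) = sl2j_scale c (sl2j_of p)" by (simp add: sl2j_scale.abs_eq)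

lemma sl2j_of_eq_iff: "sl2j_of p = sl2j_of q \<longleftrightarrow> p - q \<in> two_sided_ideal sl2j_relators"
  by (fact sl2j.abs_eq_iff)

lemma rep_sl2j_of: "rep_sl2j (sl2j_of p) - p \<in> two_sided_ideal sl2j_relators"
  using Quotient_rep_abs [OF Quotient_sl2j, of p] sl2j.abs_eq_iff
  by (metis Quotient_abs_rep Quotient_sl2j)

global_interpretation sl2j: vector_space "sl2j_scale :: 'k::field \<Rightarrow> 'k sl2j \<Rightarrow> 'k sl2j"
proof
  fix c d :: 'k and x y :: "'k sl2j"
  show "sl2j_scale c (x + y) = sl2j_scale c x + sl2j_scale c y"
    by transfer (simp add: fscale.scale_right_distrib two_sided_ideal.zero)
  show "sl2j_scale (c + d) x = sl2j_scale c x + sl2j_scale d x"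
    by transfer (simp add: fscale.scale_left_distrib two_sided_ideal.zero)
  show "sl2j_scale c (sl2j_scale d x) = sl2j_scale (c * d) x"
    by transfer (simp add: two_sided_ideal.zero)
  show "sl2j_scale 1 x = x"
    by transfer (simp add: two_sided_ideal.zero)
qed

lemma sl2j_scale_mult_left: "sl2j_scale c (x * y) = sl2j_scale c x * y"
  by transfer (simp add: fscale_eq_mult mult.assoc two_sided_ideal.zero)

lemma sl2j_scale_mult_right:
  fixes x y :: "'k::field sl2j"
  shows "sl2j_scale c (x * y) = x * sl2j_scale c y"
proof transfer
  fix c :: 'k and x y :: "gen word \<Rightarrow>\<^sub>0 'k"
  have "single 0 c * x = x * single 0 c"
    by (subst (1 2) sum_single [symmetric])
       (simp add: sum_distrib_left sum_distrib_right mult_single mult.commute)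
  then show "fscale c (x * y) - x * fscale c y \<in> two_sided_ideal sl2j_relators"
    by (simp add: fscale_eq_mult mult.assoc [symmetric] two_sided_ideal.zero)
qed

lemma sl2j_gen_relations:
  defines "a \<equiv> sl2j_gen Ga" and "b \<equiv> sl2j_gen Gb" and "c \<equiv> sl2j_gen Gc" and "d \<equiv> sl2j_gen Gd"
  shows "c * a - a * c = c * c" "c * c = c * d - d * c" "b * a - a * b = 1 - a * a"
    "b * d - d * b = 1 - d * d" "a * d - d * a = a * c - d * c" "c * b - b * c = a * c + c * d"
    "1 = a * d - b * c - a * c"
  unfolding a_def b_def c_def d_def sl2j_gen_def sl2j_of_mult [symmetric] sl2j_of_diff [symmetric]
    sl2j_of_add [symmetric] sl2j_of_one [symmetric] sl2j_of_eq_iff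
  by (rule two_sided_ideal.gen, simp add: sl2j_relators_def Let_def)+

lemma sl2j_normal_form:
  defines "a \<equiv> sl2j_gen Ga :: 'k::field sl2j" and "b \<equiv> sl2j_gen Gb :: 'k sl2j"
    and "c \<equiv> sl2j_gen Gc :: 'k sl2j" and "d \<equiv> sl2j_gen Gd :: 'k sl2j"
  shows "c * a = a * c + c * c" "b * a = a * b + 1 - a * a" "b * d = d * b + 1 - d * d"
    "c * b = b * c + a * c + c * d" "a * d = 1 + b * c + a * c"
    "d * c = c * d - c * c" "d * a = a * d - a * c + c * d - c * c"
proof -
  note rel = sl2j_gen_relations [where 'a = 'k, folded a_def b_def c_def d_def]
  show "c * a = a * c + c * c" "b * a = a * b + 1 - a * a" "b * d = d * b + 1 - d * d"
    "c * b = b * c + a * c + c * d" "a * d = 1 + b * c + a * c"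
    using rel(1) rel(3) rel(4) rel(6) rel(7) by (simp_all add: diff_eq_eq algebra_simps)
  have "d * a = a * d - a * c + d * c"
    using rel(5) by (simp add: algebra_simps)
  moreover show "d * c = c * d - c * c"
    using rel(2) by (simp add: algebra_simps)
  ultimately show "d * a = a * d - a * c + c * d - c * c"
    by simp
qed

lemma sl2j_induct [case_names zero add scale one gen]:
  fixes x :: "'k::field sl2j"
  assumes "P 0" "\<And>x y. P x \<Longrightarrow> P y \<Longrightarrow> P (x + y)" "\<And>c x. P x \<Longrightarrow> P (sl2j_scale c x)"
    "P 1" "\<And>g x. P x \<Longrightarrow> P (sl2j_gen g * x)"
  shows "P x"
proof -
  have word: "P (sl2j_of (single (Word gs) 1))" for gs
  proof (induction gs)
    case Nil
    then show ?case using assms(4) by (simp add: zero_word_def [symmetric] sl2j_of_one)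
  next
    case (Cons g gs)
    have "single (Word (g # gs)) (1::'k) = var g * single (Word gs) 1"
      by (simp add: mult_single plus_word_def)
    then show ?case using assms(5) [OF Cons] by (simp add: sl2j_of_mult sl2j_gen_def)
  qed
  have "P (sl2j_of (single w c))" for w c
    using assms(3) [OF word [of "letters w"], of c]
    by (simp add: sl2j_of_fscale [symmetric])
  moreover have "P (sl2j_of (p + q))" if "P (sl2j_of p)" "P (sl2j_of q)" for p q
    using assms(2) [OF that] by (simp add: sl2j_of_add)
  moreover have "P (sl2j_of 0)" using assms(1) by (simp add: sl2j_of_zero)
  ultimately have sum: "P (sl2j_of (\<Sum>w\<in>A. single w (f w)))" for A f
    by (induction A rule: infinite_finite_induct) simp_all
  show ?thesis
    using sum [of "\<lambda>w. lookup (rep_sl2j x) w" "keys (rep_sl2j x)"]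
    by (simp add: sum_single Quotient_abs_rep [OF Quotient_sl2j])
qed

subsection \<open>The comultiplication respects the relations\<close>

definition comult_eval ::
  "('k::field \<Rightarrow> 'v \<Rightarrow> 'v) \<Rightarrow> ('k sl2j \<Rightarrow> 'k sl2j \<Rightarrow> 'v) \<Rightarrow> (gen word \<Rightarrow>\<^sub>0 'k) \<Rightarrow> 'v::ab_group_add" where
  "comult_eval s f p = linext s (\<lambda>w. linext s (\<lambda>(x, y). f x y) (comult_word (letters w))) p"

context vector_space
begin

lemma linext_comult_append:
  "linext scale (\<lambda>(x, y). f x y) (comult_word (gs @ hs)) =
   linext scale (\<lambda>(x, y). linext scale (\<lambda>(x', y'). f (x * x') (y * y')) (comult_word hs)) (comult_word gs)"
proof (induction gs arbitrary: f)
  case Nil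
  then show ?case by (simp add: case_prod_unfold)
next
  case (Cons g gs)
  show ?case
    by (simp add: linext_fmult Cons.IH mult.assoc)
qed

lemma comult_eval_add: "comult_eval scale f (p + q) = comult_eval scale f p + comult_eval scale f q"
  by (simp add: comult_eval_def linext_add)

lemma comult_eval_diff: "comult_eval scale f (p - q) = comult_eval scale f p - comult_eval scale f q"
  by (simp add: comult_eval_def linext_diff)

lemma comult_eval_one: "comult_eval scale f 1 = f 1 1"
  by (simp add: comult_eval_def linext_one zero_word_def)

lemma comult_eval_times:
  "comult_eval scale f (p * q) = linext scale (\<lambda>u. linext scale (\<lambda>(x, y).
     comult_eval scale (\<lambda>x' y'. f (x * x') (y * y')) q) (comult_word (letters u))) p"
proof -
  have "comult_eval scale f (p * q) = linext scale (\<lambda>u. linext scale (\<lambda>v. linext scale (\<lambda>(x, y).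
     linext scale (\<lambda>(x', y'). f (x * x') (y * y')) (comult_word (letters v))) (comult_word (letters u))) q) p"
    by (simp add: comult_eval_def linext_times plus_word_def linext_comult_append)
  also have "\<dots> = linext scale (\<lambda>u. linext scale (\<lambda>(x, y).
     comult_eval scale (\<lambda>x' y'. f (x * x') (y * y')) q) (comult_word (letters u))) p"
    by (subst linext_swap) (simp add: comult_eval_def case_prod_unfold)
  finally show ?thesis .
qed

lemma comult_eval_times':
  "comult_eval scale f (p * q) = linext scale (\<lambda>v. linext scale (\<lambda>(x', y').
     comult_eval scale (\<lambda>x y. f (x * x') (y * y')) p) (comult_word (letters v))) q"
proof -
  have "comult_eval scale f (p * q) = linext scale (\<lambda>u. linext scale (\<lambda>v. linext scale (\<lambda>(x, y).
     linext scale (\<lambda>(x', y'). f (x * x') (y * y')) (comult_word (letters v))) (comult_word (letters u))) q) p"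
    by (simp add: comult_eval_def linext_times plus_word_def linext_comult_append)
  also have "\<dots> = linext scale (\<lambda>v. linext scale (\<lambda>u. linext scale (\<lambda>(x', y').
     linext scale (\<lambda>(x, y). f (x * x') (y * y')) (comult_word (letters u))) (comult_word (letters v))) p) q"
    by (subst linext_swap, unfold case_prod_unfold, subst (2) linext_swap) simp
  also have "\<dots> = linext scale (\<lambda>v. linext scale (\<lambda>(x', y').
     comult_eval scale (\<lambda>x y. f (x * x') (y * y')) p) (comult_word (letters v))) q"
    by (subst linext_swap) (simp add: comult_eval_def case_prod_unfold)
  finally show ?thesis .
qed

lemma comult_eval_var: "comult_eval scale f (var g) = linext scale (\<lambda>(x, y). f x y) (comult_gen g)"
  by (simp add: comult_eval_def linext_fmult)

lemma comult_eval_var_times: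
  "comult_eval scale f (var g * q) =
   linext scale (\<lambda>(x, y). comult_eval scale (\<lambda>x' y'. f (x * x') (y * y')) q) (comult_gen g)"
  by (subst comult_eval_times) (simp add: linext_fmult)

lemma bilin_mult_left:
  "bilin sl2j_scale sl2j_scale scale f \<Longrightarrow>
   bilin sl2j_scale sl2j_scale scale (\<lambda>x' y'. f (x * x') (y * y'))"
  by (simp add: bilin_def distrib_left sl2j_scale_mult_right [symmetric])

lemma bilin_mult_right:
  "bilin sl2j_scale sl2j_scale scale f \<Longrightarrow>
   bilin sl2j_scale sl2j_scale scale (\<lambda>x' y'. f (x' * x) (y' * y))"
  by (simp add: bilin_def distrib_right sl2j_scale_mult_left [symmetric])

lemma comult_eval_relators:
  assumes f: "bilin sl2j_scale sl2j_scale scale f" and r: "r \<in> sl2j_relators"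
  shows "comult_eval scale f r = 0"
proof -
  define a b c d :: "'a sl2j" where "a = sl2j_gen Ga" and "b = sl2j_gen Gb"
    and "c = sl2j_gen Gc" and "d = sl2j_gen Gd"
  note nf = sl2j_normal_form [where 'k = 'a, folded a_def b_def c_def d_def]
  note b = bilinD [OF f]
  have gens: "linext scale (\<lambda>(x, y). g x y) (comult_gen Ga) = g a a + g b c"
    "linext scale (\<lambda>(x, y). g x y) (comult_gen Gb) = g a b + g b d"
    "linext scale (\<lambda>(x, y). g x y) (comult_gen Gc) = g c a + g d c"
    "linext scale (\<lambda>(x, y). g x y) (comult_gen Gd) = g c b + g d d" for g
    by (simp_all add: comult_gen_def Let_def linext_add a_def b_def c_def d_def)
  show ?thesis
    using r unfolding sl2j_relators_def Let_def insert_iff empty_iff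
    apply (elim disjE)
    apply (simp_all add: comult_eval_diff comult_eval_add comult_eval_one comult_eval_var_times comult_eval_var gens)
    apply (simp_all add: nf)
    apply (simp_all add: b)
    done
qed

lemma comult_eval_ideal:
  assumes "p \<in> two_sided_ideal sl2j_relators" "bilin sl2j_scale sl2j_scale scale f"
  shows "comult_eval scale f p = 0"
  using assms
proof (induction arbitrary: f)
  case zero
  then show ?case by (simp add: comult_eval_def)
next
  case (gen r)
  then show ?case by (simp add: comult_eval_relators)
next
  case (add r r')
  then show ?case by (simp add: comult_eval_add)
next
  case (mult_left r x)
  then show ?case
    by (simp add: comult_eval_times bilin_mult_left linext_fun_zero case_prod_unfold)
next
  case (mult_right r x)
  then show ?case
    by (simp add: comult_eval_times' bilin_mult_right linext_fun_zero case_prod_unfold)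
qed

end

lemma sl2j_cases: obtains p where "x = sl2j_of p"
  by (metis Quotient_abs_rep [OF Quotient_sl2j])

lemma hscale_sl2j [simp]: "hscale sl2j = sl2j_scale"
  by (simp add: sl2j_def)

context vector_space
begin

lemma comult_eval_fun:
  "comult_eval scale (\<lambda>x y. f x y + g x y) p = comult_eval scale f p + comult_eval scale g p"
  "comult_eval scale (\<lambda>x y. scale c (f x y)) p = scale c (comult_eval scale f p)"
  by (simp_all add: comult_eval_def case_prod_unfold linext_fun_add linext_fun_scale)

lemma tlift_comult_of:
  assumes f: "bilin sl2j_scale sl2j_scale scale f"
  shows "tlift scale f (comult sl2j (sl2j_of p)) = comult_eval scale f p"
proof -
  have "tlift scale f (comult sl2j (sl2j_of p)) = comult_eval scale f (rep_sl2j (sl2j_of p))"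
    by (simp add: sl2j_def tlift_tcls [OF f] linext_lin comult_eval_def)
  then show ?thesis
    using comult_eval_ideal [OF rep_sl2j_of f, of p] by (simp add: comult_eval_diff)
qed

lemma bilin_comult_eval:
  assumes f: "bilin sl2j_scale sl2j_scale scale f"
  shows "bilin sl2j_scale sl2j_scale scale
    (\<lambda>x y. comult_eval scale (\<lambda>x' y'. f (x * x') (y * y')) q)"
  using bilinD(1-4) [OF f]
  by (simp add: bilin_def comult_eval_fun distrib_right sl2j_scale_mult_left [symmetric])

lemma tlift_comult:
  assumes f: "bilin sl2j_scale sl2j_scale scale f"
  shows tlift_comult_zero: "tlift scale f (comult sl2j 0) = 0"
    and tlift_comult_add: "tlift scale f (comult sl2j (x + y)) = tlift scale f (comult sl2j x) + tlift scale f (comult sl2j y)"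
    and tlift_comult_scale: "tlift scale f (comult sl2j (sl2j_scale c x)) = scale c (tlift scale f (comult sl2j x))"
    and tlift_comult_one: "tlift scale f (comult sl2j 1) = f 1 1"
    and tlift_comult_mult: "tlift scale f (comult sl2j (x * y)) =
      tlift scale (\<lambda>x y'. tlift scale (\<lambda>x' y''. f (x * x') (y' * y'')) (comult sl2j y)) (comult sl2j x)"
    and tlift_comult_gen: "tlift scale f (comult sl2j (sl2j_gen g)) = linext scale (\<lambda>(x, y). f x y) (comult_gen g)"
proof -
  note of = tlift_comult_of [OF f]
  obtain p where p: "x = sl2j_of p" by (rule sl2j_cases)
  obtain q where q: "y = sl2j_of q" by (rule sl2j_cases)
  show "tlift scale f (comult sl2j 0) = 0"
    using of [of 0] by (simp add: sl2j_of_zero comult_eval_def)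
  show "tlift scale f (comult sl2j (x + y)) = tlift scale f (comult sl2j x) + tlift scale f (comult sl2j y)"
    by (simp add: p q of comult_eval_add flip: sl2j_of_add)
  show "tlift scale f (comult sl2j (sl2j_scale c x)) = scale c (tlift scale f (comult sl2j x))"
    by (simp add: p of comult_eval_def linext_fscale flip: sl2j_of_fscale)
  show "tlift scale f (comult sl2j 1) = f 1 1"
    using of [of 1] by (simp add: sl2j_of_one comult_eval_one)
  show "tlift scale f (comult sl2j (sl2j_gen g)) = linext scale (\<lambda>(x, y). f x y) (comult_gen g)"
    by (simp add: sl2j_gen_def of comult_eval_var)
  have "tlift scale f (comult sl2j (x * y)) =
      comult_eval scale (\<lambda>x y'. comult_eval scale (\<lambda>x' y''. f (x * x') (y' * y'')) q) p"
    unfolding p q sl2j_of_mult [symmetric] of comult_eval_times by (simp add: comult_eval_def)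
  then show "tlift scale f (comult sl2j (x * y)) =
      tlift scale (\<lambda>x y'. tlift scale (\<lambda>x' y''. f (x * x') (y' * y'')) (comult sl2j y)) (comult sl2j x)"
    by (simp add: p q tlift_comult_of bilin_mult_left f bilin_comult_eval)
qed

lemma tlift_comult_gen_mult:
  assumes f: "bilin sl2j_scale sl2j_scale scale f"
  shows "tlift scale f (comult sl2j (sl2j_gen g * y)) =
    linext scale (\<lambda>(x, y'). tlift scale (\<lambda>x' y''. f (x * x') (y' * y'')) (comult sl2j y)) (comult_gen g)"
proof -
  obtain q where q: "y = sl2j_of q" by (rule sl2j_cases)
  have "bilin sl2j_scale sl2j_scale scale
      (\<lambda>x y'. tlift scale (\<lambda>x' y''. f (x * x') (y' * y'')) (comult sl2j y))"
    by (simp add: q tlift_comult_of bilin_mult_left f bilin_comult_eval)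
  then show ?thesis
    by (simp add: tlift_comult_mult [OF f] tlift_comult_gen)
qed

lemma linext_comult_gen:
  "linext scale (\<lambda>(x, y). f x y) (comult_gen Ga) =
     f (sl2j_gen Ga) (sl2j_gen Ga) + f (sl2j_gen Gb) (sl2j_gen Gc)"
  "linext scale (\<lambda>(x, y). f x y) (comult_gen Gb) =
     f (sl2j_gen Ga) (sl2j_gen Gb) + f (sl2j_gen Gb) (sl2j_gen Gd)"
  "linext scale (\<lambda>(x, y). f x y) (comult_gen Gc) =
     f (sl2j_gen Gc) (sl2j_gen Ga) + f (sl2j_gen Gd) (sl2j_gen Gc)"
  "linext scale (\<lambda>(x, y). f x y) (comult_gen Gd) =
     f (sl2j_gen Gc) (sl2j_gen Gb) + f (sl2j_gen Gd) (sl2j_gen Gd)"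
  by (simp_all add: comult_gen_def Let_def linext_add)

lemma tlift_fun:
  "tlift scale (\<lambda>x y. f x y + g x y) X = tlift scale f X + tlift scale g X"
  "tlift scale (\<lambda>x y. scale c (f x y)) X = scale c (tlift scale f X)"
  "tlift scale (\<lambda>x y. 0) X = 0"
  by (simp_all add: tlift_def case_prod_unfold linext_fun_add linext_fun_scale linext_fun_zero)

lemma tlift_swap:
  "tlift scale (\<lambda>x y. tlift scale (\<lambda>x' y'. f x y x' y') Y) X =
   tlift scale (\<lambda>x' y'. tlift scale (\<lambda>x y. f x y x' y') X) Y"
  by (simp add: tlift_def case_prod_unfold linext_swap [of _ "trep Y"])

lemma linear_tlift:
  assumes "Vector_Spaces.linear scale s' T"
  shows "T (tlift scale f X) = tlift s' (\<lambda>x y. T (f x y)) X"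
  by (simp add: tlift_def linear_linext [OF assms] case_prod_unfold)

end

lemmas klift_comult = vector_space.tlift_comult [OF vector_space_times]
lemmas klift_fun = vector_space.tlift_fun [OF vector_space_times]
lemmas klift_swap = vector_space.tlift_swap [OF vector_space_times]

lemma comult_sl2j_tprod: "comult sl2j x \<in> tprod (uvs sl2j_scale) (uvs sl2j_scale)"
  by (simp add: sl2j_def tprod_def)

lemma tprod_eqI:
  fixes X Y :: "('v::ab_group_add \<times> 'w::ab_group_add \<Rightarrow>\<^sub>0 'k::field) set"
  assumes "X \<in> tprod (uvs s1) (uvs s2)" "Y \<in> tprod (uvs s1) (uvs s2)"
    and "\<And>f. bilin s1 s2 (*) f \<Longrightarrow> tlift (*) f X = tlift (*) f Y"
  shows "X = Y"
proof -
  obtain p q where X: "X = tcls (uvs s1) (uvs s2) p" and Y: "Y = tcls (uvs s1) (uvs s2) q"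
    using assms(1,2) by (auto simp: tprod_def)
  show ?thesis unfolding X Y
  proof (rule tcls_eqI)
    fix f :: "'v \<Rightarrow> 'w \<Rightarrow> 'k"
    assume f: "bilin s1 s2 (*) f"
    show "linext (*) (\<lambda>(x, y). f x y) p = linext (*) (\<lambda>(x, y). f x y) q"
      using assms(3) [OF f]
      by (simp add: X Y vector_space.tlift_tcls [OF vector_space_times f])
  qed
qed

lemma tcls_tprod: "tcls (uvs s1) (uvs s2) p \<in> tprod (uvs s1) (uvs s2)"
  by (simp add: tprod_def)

lemma tlift_tops:
  fixes f :: "'v::ab_group_add \<Rightarrow> 'w::ab_group_add \<Rightarrow> 'k::field"
  assumes f: "bilin s1 s2 (*) f"
  shows "tlift (*) f (tadd (uvs s1) (uvs s2) X Y) = tlift (*) f X + tlift (*) f Y"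
    "tlift (*) f (tscale (uvs s1) (uvs s2) c X) = c * tlift (*) f X"
    "tlift (*) f (tcls (uvs s1) (uvs s2) (single (x, y) 1)) = f x y"
  by (simp_all add: tadd_def tscale_def vector_space.tlift_tcls [OF vector_space_times f]
        kext_add kext_fscale kext_single) (simp_all add: tlift_def)

lemma tlift_tmult:
  fixes f :: "'a::ring_1 \<Rightarrow> 'b::ring_1 \<Rightarrow> 'k::field"
  assumes f: "bilin s1 s2 (*) f"
  shows "tlift (*) f (tmult (uvs s1) (uvs s2) X Y) =
    tlift (*) (\<lambda>x y. tlift (*) (\<lambda>x' y'. f (x * x') (y * y')) Y) X"
  by (simp add: tmult_def vector_space.tlift_tcls [OF vector_space_times f]
        vector_space.linext_fmult [OF vector_space_times]) (simp add: tlift_def)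


subsection \<open>Counit and antipode\<close>

lemma counit_sl2j_of: "counit sl2j (sl2j_of p) = linext (*) (\<lambda>w. counit_word (letters w)) p"
proof -
  have "counit sl2j (sl2j_of p) = linext (*) (\<lambda>w. counit_word (letters w)) (rep_sl2j (sl2j_of p))"
    by (simp add: sl2j_def)
  then show ?thesis
    using linext_counit_ideal [OF rep_sl2j_of, of p] by (simp add: kext_diff)
qed

lemma counit_sl2j:
  "counit sl2j 0 = 0" "counit sl2j (x + y) = counit sl2j x + counit sl2j y"
  "counit sl2j (sl2j_scale c x) = c * counit sl2j x" "counit sl2j 1 = 1"
  "counit sl2j (x * y) = counit sl2j x * counit sl2j y" "counit sl2j (sl2j_gen g) = counit_gen g"
proof -
  obtain p where p: "x = sl2j_of p" by (rule sl2j_cases)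
  obtain q where q: "y = sl2j_of q" by (rule sl2j_cases)
  show "counit sl2j 0 = 0"
    using counit_sl2j_of [of 0] by (simp add: sl2j_of_zero kext_zero)
  show "counit sl2j 1 = 1"
    using counit_sl2j_of [of 1]
    by (simp add: sl2j_of_one kext_one counit_word_def zero_word_def)
  show "counit sl2j (x + y) = counit sl2j x + counit sl2j y"
    by (simp add: p q counit_sl2j_of kext_add flip: sl2j_of_add)
  show "counit sl2j (sl2j_scale c x) = c * counit sl2j x"
    by (simp add: p counit_sl2j_of kext_fscale flip: sl2j_of_fscale)
  show "counit sl2j (x * y) = counit sl2j x * counit sl2j y"
    by (simp add: p q counit_sl2j_of linext_counit_times flip: sl2j_of_mult)
  show "counit sl2j (sl2j_gen g) = counit_gen g"
    by (simp add: sl2j_gen_def counit_sl2j_of kext_single counit_word_def)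
qed

lemma antipode_word_append: "antipode_word (gs @ hs) = antipode_word hs * antipode_word gs"
  by (simp add: antipode_word_def)

lemma linext_antipode_times:
  "linext sl2j_scale (\<lambda>w. antipode_word (letters w)) (p * q) =
   linext sl2j_scale (\<lambda>w. antipode_word (letters w)) q * linext sl2j_scale (\<lambda>w. antipode_word (letters w)) p"
  (is "?S (p * q) = _")
proof -
  have l: "linext sl2j_scale (\<lambda>w. f w * y) r = linext sl2j_scale f r * y"
    and r: "linext sl2j_scale (\<lambda>w. x * f w) r = x * linext sl2j_scale f r"
    for f :: "gen word \<Rightarrow> 'a sl2j" and r x y
    by (simp_all add: linext_def sum_distrib_left sum_distrib_right
          sl2j_scale_mult_left [symmetric] sl2j_scale_mult_right [symmetric])
  show ?thesis
    by (simp add: sl2j.linext_times plus_word_def antipode_word_append l r)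
qed

lemma linext_antipode_ideal:
  assumes "p \<in> two_sided_ideal sl2j_relators"
  shows "linext sl2j_scale (\<lambda>w. antipode_word (letters w)) p = (0 :: 'k::field sl2j)"
  using assms
proof induction
  case (gen r)
  define a b c d :: "'k sl2j" where "a = sl2j_gen Ga" and "b = sl2j_gen Gb"
    and "c = sl2j_gen Gc" and "d = sl2j_gen Gd"
  note nf = sl2j_normal_form [where 'k = 'k, folded a_def b_def c_def d_def]
  have word: "antipode_word [g] = (antipode_gen g :: 'k sl2j)" "antipode_word [] = (1 :: 'k sl2j)" for g
    by (simp_all add: antipode_word_def)
  have gens: "antipode_gen Ga = d - c" "antipode_gen Gb = a - b + c - d" "antipode_gen Gc = - c"
    "antipode_gen Gd = a + c"
    by (simp_all add: antipode_gen_def Let_def a_def b_def c_def d_def)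
  show ?case
    using gen unfolding sl2j_relators_def Let_def insert_iff empty_iff
    apply (elim disjE)
    apply (simp_all add: sl2j.linext_add sl2j.linext_diff linext_antipode_times
        sl2j.linext_one zero_word_def word gens)
    apply (simp_all add: distrib_left distrib_right left_diff_distrib right_diff_distrib nf)
    done
qed (simp_all add: sl2j.linext_add linext_antipode_times)

lemma antipode_sl2j_of: "antipode sl2j (sl2j_of p) = linext sl2j_scale (\<lambda>w. antipode_word (letters w)) p"
proof -
  have "antipode sl2j (sl2j_of p) = linext sl2j_scale (\<lambda>w. antipode_word (letters w)) (rep_sl2j (sl2j_of p))"
    by (simp add: sl2j_def)
  then show ?thesis
    using linext_antipode_ideal [OF rep_sl2j_of, of p] by (simp add: sl2j.linext_diff)
qed

lemma antipode_sl2j: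
  "antipode sl2j 0 = 0" "antipode sl2j (x + y) = antipode sl2j x + antipode sl2j y"
  "antipode sl2j (sl2j_scale c x) = sl2j_scale c (antipode sl2j x)" "antipode sl2j 1 = 1"
  "antipode sl2j (x * y) = antipode sl2j y * antipode sl2j x"
  "antipode sl2j (sl2j_gen g) = antipode_gen g"
proof -
  obtain p where p: "x = sl2j_of p" by (rule sl2j_cases)
  obtain q where q: "y = sl2j_of q" by (rule sl2j_cases)
  show "antipode sl2j 0 = 0"
    using antipode_sl2j_of [of 0] by (simp add: sl2j_of_zero)
  show "antipode sl2j 1 = 1"
    using antipode_sl2j_of [of 1]
    by (simp add: sl2j_of_one sl2j.linext_one antipode_word_def zero_word_def)
  show "antipode sl2j (x + y) = antipode sl2j x + antipode sl2j y"
    by (simp add: p q antipode_sl2j_of sl2j.linext_add flip: sl2j_of_add)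
  show "antipode sl2j (sl2j_scale c x) = sl2j_scale c (antipode sl2j x)"
    by (simp add: p antipode_sl2j_of sl2j.linext_fscale flip: sl2j_of_fscale)
  show "antipode sl2j (x * y) = antipode sl2j y * antipode sl2j x"
    by (simp add: p q antipode_sl2j_of linext_antipode_times flip: sl2j_of_mult)
  show "antipode sl2j (sl2j_gen g) = antipode_gen g"
    by (simp add: sl2j_gen_def antipode_sl2j_of antipode_word_def)
qed


lemma bilin_tlift_right:
  fixes f :: "'v::ab_group_add \<Rightarrow> 'k::field sl2j \<Rightarrow> 'k sl2j \<Rightarrow> 'k"
  assumes "trilin s sl2j_scale sl2j_scale (*) f"
  shows "bilin s sl2j_scale (*) (\<lambda>x y. tlift (*) (\<lambda>u v. f x u v) (comult sl2j y))"
proof -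
  have a: "bilin sl2j_scale sl2j_scale (*) (f x)" and b: "bilin s sl2j_scale (*) (\<lambda>x. f x y)" for x y
    using assms by (auto simp: trilin_def)
  have "f (x + x') = (\<lambda>u v. f x u v + f x' u v)" "f (s c x) = (\<lambda>u v. c * f x u v)" for x x' c
    by (simp_all add: fun_eq_iff bilinD(1,2) [OF b])
  then show ?thesis
    unfolding bilin_def by (simp add: klift_comult [OF a] klift_fun)
qed

lemma bilin_tlift_left:
  fixes f :: "'k::field sl2j \<Rightarrow> 'k sl2j \<Rightarrow> 'v::ab_group_add \<Rightarrow> 'k"
  assumes "trilin sl2j_scale sl2j_scale s (*) f"
  shows "bilin sl2j_scale s (*) (\<lambda>x y. tlift (*) (\<lambda>u v. f u v y) (comult sl2j x))"
proof -
  have a: "bilin sl2j_scale sl2j_scale (*) (\<lambda>u v. f u v y)" and b: "bilin sl2j_scale s (*) (f x)" for x y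
    using assms by (auto simp: trilin_def)
  show ?thesis
    unfolding bilin_def
    by (simp add: klift_comult [OF a] bilinD(3,4) [OF b] klift_fun)
qed

lemma trilin_mult_left:
  "trilin sl2j_scale sl2j_scale sl2j_scale (*) f \<Longrightarrow>
   trilin sl2j_scale sl2j_scale sl2j_scale (*) (\<lambda>x' y' z'. f (x * x') (y * y') (z * z'))"
  by (simp add: trilin_def bilin_def distrib_left sl2j_scale_mult_right [symmetric])

lemma sl2j_coassoc_form:
  fixes f :: "'k::field sl2j \<Rightarrow> 'k sl2j \<Rightarrow> 'k sl2j \<Rightarrow> 'k"
  assumes "trilin sl2j_scale sl2j_scale sl2j_scale (*) f"
  shows "tlift (*) (\<lambda>x z. tlift (*) (\<lambda>u v. f u v z) (comult sl2j x)) (comult sl2j t) =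
         tlift (*) (\<lambda>u x. tlift (*) (\<lambda>v w. f u v w) (comult sl2j x)) (comult sl2j t)"
  using assms
proof (induction t arbitrary: f rule: sl2j_induct)
  case zero
  show ?case
    by (simp add: klift_comult(1) [OF bilin_tlift_left [OF zero]] klift_comult(1) [OF bilin_tlift_right [OF zero]])
next
  case (add x y)
  note l = klift_comult(2) [OF bilin_tlift_left [OF add.prems]]
  note r = klift_comult(2) [OF bilin_tlift_right [OF add.prems]]
  show ?case unfolding l r add.IH(1) [OF add.prems] add.IH(2) [OF add.prems] ..
next
  case (scale c x)
  note l = klift_comult(3) [OF bilin_tlift_left [OF scale.prems]]
  note r = klift_comult(3) [OF bilin_tlift_right [OF scale.prems]]
  show ?case unfolding l r scale.IH [OF scale.prems] ..
next
  case one
  have "bilin sl2j_scale sl2j_scale (*) (f x)" "bilin sl2j_scale sl2j_scale (*) (\<lambda>u v. f u v x)" for x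
    using one by (auto simp: trilin_def)
  then show ?case
    by (simp add: klift_comult(4) [OF bilin_tlift_left [OF one]] klift_comult(4) [OF bilin_tlift_right [OF one]]
          klift_comult(4))
next
  case (gen g t)
  have f1: "bilin sl2j_scale sl2j_scale (*) (f x)"
    and f2: "bilin sl2j_scale sl2j_scale (*) (\<lambda>x z. f x y z)"
    and f3: "bilin sl2j_scale sl2j_scale (*) (\<lambda>x y. f x y z)" for x y z
    using gen.prems by (auto simp: trilin_def)
  note gm = vector_space.tlift_comult_gen_mult [OF vector_space_times]
  define G where "G u v z = tlift (*) (\<lambda>u' x'. tlift (*) (\<lambda>v' w'. f (u * u') (v * v') (z * w'))
    (comult sl2j x')) (comult sl2j t)" for u v z
  have G: "G u v z = tlift (*) (\<lambda>x' z'. tlift (*) (\<lambda>u' v'. f (u * u') (v * v') (z * z'))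
    (comult sl2j x')) (comult sl2j t)" for u v z
    unfolding G_def by (rule gen.IH [symmetric]) (rule trilin_mult_left [OF gen.prems])
  have "trilin sl2j_scale sl2j_scale sl2j_scale (*) G"
    by (simp add: trilin_def bilin_def G_def distrib_right sl2j_scale_mult_left [symmetric]
          bilinD(1-4) [OF f1] bilinD(1,2) [OF f2] klift_fun)
  then have G1: "bilin sl2j_scale sl2j_scale (*) (G x)"
    and G3: "bilin sl2j_scale sl2j_scale (*) (\<lambda>x y. G x y z)" for x z
    by (auto simp: trilin_def)
  have "tlift (*) (\<lambda>x z. tlift (*) (\<lambda>u v. f u v z) (comult sl2j x)) (comult sl2j (sl2j_gen g * t)) =
    linext (*) (\<lambda>(x, z). tlift (*) (\<lambda>u v. G u v z) (comult sl2j x)) (comult_gen g)"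
    by (simp add: gm [OF bilin_tlift_left [OF gen.prems]] klift_comult(5) [OF f3] G)
       (subst klift_swap, rule refl)
  also have "\<dots> = linext (*) (\<lambda>(u, x). tlift (*) (G u) (comult sl2j x)) (comult_gen g)"
    by (cases g) (simp_all add: vector_space.linext_comult_gen [OF vector_space_times]
          klift_comult(6) [OF G1] klift_comult(6) [OF G3])
  also have "\<dots> = tlift (*) (\<lambda>u x. tlift (*) (\<lambda>v w. f u v w) (comult sl2j x)) (comult sl2j (sl2j_gen g * t))"
    by (simp add: gm [OF bilin_tlift_right [OF gen.prems]] klift_comult(5) [OF f1] G_def [abs_def])
       (subst klift_swap, rule refl)
  finally show ?case .
qed

lemma bilin_sl2j_mult:
  fixes T U :: "'k::field sl2j \<Rightarrow> 'k sl2j"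
  assumes "\<And>x y. T (x + y) = T x + T y" "\<And>c x. T (sl2j_scale c x) = sl2j_scale c (T x)"
    and "\<And>x y. U (x + y) = U x + U y" "\<And>c x. U (sl2j_scale c x) = sl2j_scale c (U x)"
  shows "bilin sl2j_scale sl2j_scale sl2j_scale (\<lambda>x y. T x * U y)"
  by (simp add: bilin_def assms distrib_left distrib_right
        sl2j_scale_mult_left [symmetric] sl2j_scale_mult_right [symmetric])

lemma sl2j_tlift_mult:
  fixes X :: "('k::field sl2j \<times> 'k sl2j \<Rightarrow>\<^sub>0 'k) set"
  shows "tlift sl2j_scale (\<lambda>x y. z * f x y * z') X = z * tlift sl2j_scale f X * z'"
proof -
  have "Vector_Spaces.linear sl2j_scale sl2j_scale (\<lambda>x. z * x * z')"
    by unfold_locales (simp_all add: distrib_left distrib_right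
        sl2j_scale_mult_left [symmetric] sl2j_scale_mult_right [symmetric])
  from sl2j.linear_tlift [OF this, symmetric] show ?thesis .
qed

lemma antipode_gen_left:
    "linext sl2j_scale (\<lambda>(x, y). antipode sl2j x * y) (comult_gen g) = sl2j_scale (counit_gen g) (1 :: 'k::field sl2j)"
  and antipode_gen_right:
    "linext sl2j_scale (\<lambda>(x, y). x * antipode sl2j y) (comult_gen g) = sl2j_scale (counit_gen g) (1 :: 'k::field sl2j)"
proof -
  note antipode_gen = antipode_sl2j(6) antipode_gen_def Let_def
  note simps = sl2j.linext_comult_gen antipode_gen counit_gen_def
    distrib_left distrib_right left_diff_distrib right_diff_distrib sl2j_normal_form
  show "linext sl2j_scale (\<lambda>(x, y). antipode sl2j x * y) (comult_gen g) = sl2j_scale (counit_gen g) (1 :: 'k sl2j)"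
    by (cases g) (simp_all add: simps)
  show "linext sl2j_scale (\<lambda>(x, y). x * antipode sl2j y) (comult_gen g) = sl2j_scale (counit_gen g) (1 :: 'k sl2j)"
    by (cases g) (simp_all add: simps)
qed

theorem hopf_algebra_sl2j: "hopf_algebra (sl2j :: ('k::field, 'k sl2j) hopf)"
proof -
  have Sbil: "bilin sl2j_scale sl2j_scale sl2j_scale (\<lambda>u v. antipode sl2j u * v :: 'k sl2j)"
    using bilin_sl2j_mult [of "antipode sl2j" "\<lambda>x. x"] by (simp add: antipode_sl2j)
  have Sbil': "bilin sl2j_scale sl2j_scale sl2j_scale (\<lambda>u v. u * antipode sl2j v :: 'k sl2j)"
    using bilin_sl2j_mult [of "\<lambda>x. x" "antipode sl2j"] by (simp add: antipode_sl2j)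
  have Ebil: "bilin sl2j_scale sl2j_scale sl2j_scale (\<lambda>u v. sl2j_scale (counit sl2j u) v :: 'k sl2j)"
    by (simp add: bilin_def counit_sl2j sl2j.scale_left_distrib sl2j.scale_right_distrib mult.commute)
  have Ebil': "bilin sl2j_scale sl2j_scale sl2j_scale (\<lambda>u v. sl2j_scale (counit sl2j v) u :: 'k sl2j)"
    by (simp add: bilin_def counit_sl2j sl2j.scale_left_distrib sl2j.scale_right_distrib mult.commute)
  show ?thesis
    unfolding hopf_algebra_def hopf_algebra_axioms_def hscale_sl2j
  proof (intro conjI allI)
    fix c :: 'k and x y :: "'k sl2j"
    show "vector_space (sl2j_scale :: 'k \<Rightarrow> 'k sl2j \<Rightarrow> 'k sl2j)" ..
    show "sl2j_scale c (x * y) = sl2j_scale c x * y" by (rule sl2j_scale_mult_left)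
    show "sl2j_scale c (x * y) = x * sl2j_scale c y" by (rule sl2j_scale_mult_right)
    show "comult sl2j x \<in> tprod (uvs sl2j_scale) (uvs sl2j_scale)" by (rule comult_sl2j_tprod)
    show "comult sl2j (x + y) = tadd (uvs sl2j_scale) (uvs sl2j_scale) (comult sl2j x) (comult sl2j y)"
      by (rule tprod_eqI [OF comult_sl2j_tprod])
         (simp add: tadd_def tcls_tprod, simp add: tlift_tops klift_comult)
    show "comult sl2j (sl2j_scale c x) = tscale (uvs sl2j_scale) (uvs sl2j_scale) c (comult sl2j x)"
      by (rule tprod_eqI [OF comult_sl2j_tprod])
         (simp add: tscale_def tcls_tprod, simp add: tlift_tops klift_comult)
    show "comult sl2j 1 = tcls (uvs sl2j_scale) (uvs sl2j_scale) (single (1 :: 'k sl2j, 1) 1)"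
      by (rule tprod_eqI [OF comult_sl2j_tprod tcls_tprod]) (simp add: tlift_tops klift_comult)
    show "comult sl2j (x * y) = tmult (uvs sl2j_scale) (uvs sl2j_scale) (comult sl2j x) (comult sl2j y)"
      by (rule tprod_eqI [OF comult_sl2j_tprod])
         (simp add: tmult_def tcls_tprod, simp add: tlift_tmult klift_comult)
    show "counit sl2j (x + y) = counit sl2j x + counit sl2j y" by (rule counit_sl2j)
    show "counit sl2j (sl2j_scale c x) = c * counit sl2j x" by (rule counit_sl2j)
    show "counit sl2j (1 :: 'k sl2j) = 1" by (rule counit_sl2j)
    show "counit sl2j (x * y) = counit sl2j x * counit sl2j y" by (rule counit_sl2j)
    show "tmap_left (uvs sl2j_scale) (uvs sl2j_scale) (uvs sl2j_scale) (comult sl2j) (comult sl2j x)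
        = tmap_right (uvs sl2j_scale) (uvs sl2j_scale) (uvs sl2j_scale) (comult sl2j) (comult sl2j x)"
      unfolding tmap_left_def tmap_right_def
    proof (rule tcls3_eqI)
      fix f :: "'k sl2j \<Rightarrow> 'k sl2j \<Rightarrow> 'k sl2j \<Rightarrow> 'k"
      assume "trilin sl2j_scale sl2j_scale sl2j_scale (*) f"
      from sl2j_coassoc_form [OF this, of x] show
        "linext (*) (\<lambda>(x, y, z). f x y z) (lin (\<lambda>(x, z). lin (\<lambda>(u, v). single (u, v, z) 1)
           (trep (comult sl2j x))) (trep (comult sl2j x))) =
         linext (*) (\<lambda>(x, y, z). f x y z) (lin (\<lambda>(u, x). lin (\<lambda>(v, w). single (u, v, w) 1)
           (trep (comult sl2j x))) (trep (comult sl2j x)))"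
        by (simp add: kext_lin kext_single tlift_def case_prod_unfold)
    qed
    show "tlift sl2j_scale (\<lambda>u v. sl2j_scale (counit sl2j u) v) (comult sl2j x) = x"
    proof (induction x rule: sl2j_induct)
      case (gen g t)
      have "sl2j_scale (counit sl2j (z * u)) (z' * v) = sl2j_scale (counit sl2j z) z' * sl2j_scale (counit sl2j u) v"
        for z z' u v :: "'k sl2j"
        by (simp add: counit_sl2j sl2j_scale_mult_left [symmetric] sl2j_scale_mult_right [symmetric])
      then show ?case
        by (cases g) (simp_all add: sl2j.tlift_comult_gen_mult [OF Ebil] sl2j_tlift_mult [where z' = 1, simplified] gen.IH
            sl2j.linext_comult_gen counit_sl2j counit_gen_def)
    qed (simp_all add: sl2j.tlift_comult [OF Ebil] counit_sl2j)
    show "tlift sl2j_scale (\<lambda>u v. sl2j_scale (counit sl2j v) u) (comult sl2j x) = x"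
    proof (induction x rule: sl2j_induct)
      case (gen g t)
      have "sl2j_scale (counit sl2j (z' * v)) (z * u) = sl2j_scale (counit sl2j z') z * sl2j_scale (counit sl2j v) u"
        for z z' u v :: "'k sl2j"
        by (simp add: counit_sl2j sl2j_scale_mult_left [symmetric] sl2j_scale_mult_right [symmetric])
      then show ?case
        by (cases g) (simp_all add: sl2j.tlift_comult_gen_mult [OF Ebil'] sl2j_tlift_mult [where z' = 1, simplified] gen.IH
            sl2j.linext_comult_gen counit_sl2j counit_gen_def)
    qed (simp_all add: sl2j.tlift_comult [OF Ebil'] counit_sl2j)
    show "antipode sl2j (x + y) = antipode sl2j x + antipode sl2j y" by (rule antipode_sl2j)
    show "antipode sl2j (sl2j_scale c x) = sl2j_scale c (antipode sl2j x)" by (rule antipode_sl2j)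
    show "tlift sl2j_scale (\<lambda>u v. antipode sl2j u * v) (comult sl2j x) = sl2j_scale (counit sl2j x) 1"
    proof (induction x rule: sl2j_induct)
      case (gen g t)
      have eq: "antipode sl2j (x * u) * (y * v) = antipode sl2j u * (antipode sl2j x * y) * v"
        for x y u v :: "'k sl2j"
        by (simp add: antipode_sl2j mult.assoc)
      have "tlift sl2j_scale (\<lambda>u v. antipode sl2j u * v) (comult sl2j (sl2j_gen g * t)) =
          tlift sl2j_scale (\<lambda>u v. antipode sl2j u *
            linext sl2j_scale (\<lambda>(x, y). antipode sl2j x * y) (comult_gen g) * v) (comult sl2j t)"
        unfolding sl2j.tlift_comult_gen_mult [OF Sbil] eq
        by (cases g) (simp_all add: sl2j.linext_comult_gen distrib_left distrib_right sl2j.tlift_fun(1))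
      also have "\<dots> = tlift sl2j_scale (\<lambda>u v. sl2j_scale (counit_gen g) (antipode sl2j u * v)) (comult sl2j t)"
        unfolding antipode_gen_left
        by (simp add: sl2j_scale_mult_left [symmetric] sl2j_scale_mult_right [symmetric])
      finally show ?case
        by (simp add: sl2j.tlift_fun(2) gen.IH counit_sl2j)
    qed (simp_all add: sl2j.tlift_comult [OF Sbil] counit_sl2j antipode_sl2j sl2j.scale_left_distrib)
    show "tlift sl2j_scale (\<lambda>u v. u * antipode sl2j v) (comult sl2j x) = sl2j_scale (counit sl2j x) 1"
    proof (induction x rule: sl2j_induct)
      case (gen g t)
      have eq: "(x * u) * antipode sl2j (y * v) = x * (u * antipode sl2j v) * antipode sl2j y"
        for x y u v :: "'k sl2j"
        by (simp add: antipode_sl2j mult.assoc)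
      have "tlift sl2j_scale (\<lambda>u v. u * antipode sl2j v) (comult sl2j (sl2j_gen g * t)) =
          linext sl2j_scale (\<lambda>(x, y). sl2j_scale (counit sl2j t) (x * antipode sl2j y)) (comult_gen g)"
        unfolding sl2j.tlift_comult_gen_mult [OF Sbil'] eq sl2j_tlift_mult gen.IH
        by (simp add: sl2j_scale_mult_left [symmetric] sl2j_scale_mult_right [symmetric])
      also have "\<dots> = sl2j_scale (counit sl2j t) (linext sl2j_scale (\<lambda>(x, y). x * antipode sl2j y) (comult_gen g))"
        by (simp add: case_prod_unfold sl2j.linext_fun_scale)
      finally show ?case
        by (simp add: antipode_gen_right counit_sl2j mult.commute)
    qed (simp_all add: sl2j.tlift_comult [OF Sbil'] counit_sl2j antipode_sl2j sl2j.scale_left_distrib)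
  qed
qed

lemma comult_sl2j_gen:
  "comult sl2j (sl2j_gen g) = tcls (hvs sl2j) (hvs sl2j) (comult_gen g)"
  unfolding hscale_sl2j
  by (rule tprod_eqI [OF comult_sl2j_tprod tcls_tprod])
     (simp add: klift_comult vector_space.tlift_tcls [OF vector_space_times])

lemmas counit_sl2j_gen = counit_sl2j(6)
  and antipode_sl2j_gen = antipode_sl2j(6)

end

theory Submission
  imports Defs
begin

text \<open>
  The reason there is no dense big cell is that every Hopf algebra map \<open>\<pi>\<close> from the Jordanian
  \<open>SL(2)\<close> onto a pointed Hopf algebra kills the generator \<open>c\<close>
  (\<open>pointed_quotient_c_eq_0\<close>).  Since \<open>\<Delta>(c) = c \<otimes> a + d \<otimes> c\<close>, both summands of
  \<open>\<theta>(c) = (\<pi> \<otimes> \<pi>')(\<Delta>(c))\<close> then vanish.  But \<open>c \<noteq> 0\<close>, as a two-dimensional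
  representation shows (\<open>sl2j_gen_c_neq_0\<close>), so \<open>\<theta>\<close> is not injective.

  To see that \<open>\<pi>(c) = 0\<close>, consider the first row \<open>\<pi>(a), \<pi>(b)\<close> of the image of the generating
  matrix.  It spans a comodule of dimension at most two, which is not simple if the dimension is two,
  because the target is pointed.  In either case the matrix has an eigenvector \<open>(x, y)\<close> with
  entries in \<open>k\<close> and an eigenvalue \<open>g\<close> in the target (\<open>pointed_imp_invariant_line\<close>):
  \<open>x \<pi>(a) + y \<pi>(b) = x g\<close> and \<open>x \<pi>(c) + y \<pi>(d) = y g\<close>.

  The line \<open>y = 0\<close> gives \<open>\<pi>(c) = 0\<close> at once; it corresponds to the Borel subgroup of the
  Jordanian \<open>SL(2)\<close>.  Geometrically, the quantum group preserves a bilinear form on the plane,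
  and this line is its only isotropic one.  A triangular matrix preserving the form with respect to
  any other line has \<open>g\<^sup>2 = 1\<close> and an off-diagonal entry proportional to \<open>h - g\<close>; the asymmetry of the form then
  makes the two diagonal entries \<open>g\<close> and \<open>h\<close> inverse to each other when \<open>2 \<noteq> 0\<close>, so that the
  matrix is the scalar \<open>g\<close> (\<open>jordanian_eigenvector_imp_c_eq_0\<close>).
\<close>

section \<open>The generator \<open>c\<close> is nonzero\<close>

text \<open>
  The relations hold for \<open>a = d = 1\<close>, for \<open>c\<close> the elementary matrix in the upper right corner and
  for \<open>b\<close> the diagonal matrix with entries \<open>-1\<close> and \<open>1\<close>.  The matrix of a product of generators
  is upper triangular; its entries are evaluated on words.  The parameter \<open>\<beta>\<close> is the entry of \<open>b\<close>
  at the diagonal position in question.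
\<close>

definition diag_gen :: "'k::field \<Rightarrow> gen \<Rightarrow> 'k" where
  "diag_gen \<beta> g = (case g of Ga \<Rightarrow> 1 | Gb \<Rightarrow> \<beta> | Gc \<Rightarrow> 0 | Gd \<Rightarrow> 1)"

definition diag_word :: "'k::field \<Rightarrow> gen list \<Rightarrow> 'k" where
  "diag_word \<beta> gs = prod_list (map (diag_gen \<beta>) gs)"

fun corner_word :: "gen list \<Rightarrow> 'k::field" where
  "corner_word [] = 0"
| "corner_word (g # gs) = diag_gen (- 1) g * corner_word gs + (if g = Gc then diag_word 1 gs else 0)"

lemma diag_word_append: "diag_word \<beta> (gs @ hs) = diag_word \<beta> gs * diag_word \<beta> hs"
  by (simp add: diag_word_def)

lemma corner_word_append:
  "corner_word (gs @ hs) = diag_word (- 1) gs * corner_word hs + corner_word gs * diag_word 1 hs"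
  by (induction gs) (auto simp: diag_word_def algebra_simps)

abbreviation diag_entry :: "'k::field \<Rightarrow> (gen word \<Rightarrow>\<^sub>0 'k) \<Rightarrow> 'k" where
  "diag_entry \<beta> \<equiv> linext (*) (\<lambda>w. diag_word \<beta> (letters w))"

abbreviation corner_entry :: "(gen word \<Rightarrow>\<^sub>0 'k::field) \<Rightarrow> 'k" where
  "corner_entry \<equiv> linext (*) (\<lambda>w. corner_word (letters w))"

lemma kext_mult_right: "linext (*) (\<lambda>i. f i * c) p = linext (*) f p * (c::'k::field)"
  by (simp add: linext_def sum_distrib_right mult.assoc)

lemma diag_entry_times: "diag_entry \<beta> (p * q) = diag_entry \<beta> p * diag_entry \<beta> q"
  by (simp only: kext_times plus_word_def word.sel diag_word_append kext_fun_scale kext_mult_right)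

lemma corner_entry_times:
  "corner_entry (p * q) = diag_entry (- 1) p * corner_entry q + corner_entry p * diag_entry 1 q"
  by (simp only: kext_times plus_word_def word.sel corner_word_append kext_fun_add kext_fun_scale
        kext_mult_right)

text \<open>
  The two diagonal entries are multiplicative and the corner is a skew derivation with respect to
  them, so its vanishing on the ideal is proved along with theirs.
\<close>

lemma triangular_rep_ideal:
  assumes "p \<in> two_sided_ideal sl2j_relators"
  shows "diag_entry (- 1) p = (0::'k::field) \<and> diag_entry 1 p = (0::'k) \<and> corner_entry p = (0::'k)"
  using assms
proof induction
  case (gen r)
  then show ?case
    by (auto simp: sl2j_relators_def Let_def mult_single plus_word_def
          kext_single kext_add kext_diff diag_word_def diag_gen_def
          kext_one zero_word_def)
qed (simp_all add: kext_zero kext_add diag_entry_times corner_entry_times)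

lemma sl2j_gen_c_neq_0: "sl2j_gen Gc \<noteq> (0 :: 'k::field sl2j)"
proof
  assume "sl2j_gen Gc = (0 :: 'k sl2j)"
  then have "var Gc - 0 \<in> two_sided_ideal (sl2j_relators :: (gen word \<Rightarrow>\<^sub>0 'k) set)"
    unfolding sl2j_gen_def sl2j_of_zero [symmetric] sl2j_of_eq_iff .
  from triangular_rep_ideal [OF this] show False
    by (simp add: kext_single diag_word_def)
qed


section \<open>Triangular quotients\<close>


text \<open>
  The matrix of the relations has the eigenvector \<open>(z, 1)\<close> with eigenvalue \<open>g\<close>.  In the basis
  formed by \<open>(z, 1)\<close> and \<open>(1, 0)\<close> it becomes upper triangular with diagonal \<open>g, h\<close> and
  off-diagonal entry \<open>c\<close>, and the relations turn into identities between \<open>g\<close>, \<open>h\<close> and \<open>c\<close>.  They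
  first give \<open>g\<^sup>2 = 1\<close>, then \<open>c = h - g\<close>, and finally \<open>2 (h g - 1) = 0\<close>.  The scalar \<open>z\<close> of the
  ground field is represented by a central ring element.
\<close>

lemma jordanian_eigenvector_imp_c_eq_0:
  fixes a b c d g z :: "'b::ring_1"
  assumes rel: "c * a - a * c = c * c" "c * c = c * d - d * c" "b * a - a * b = 1 - a * a"
    "b * d - d * b = 1 - d * d" "a * d - d * a = a * c - d * c" "c * b - b * c = a * c + c * d"
    "1 = a * d - b * c - a * c"
    and central: "\<And>x. x * z = z * x"
    and eigen: "z * a + b = z * g" "z * c + d = g"
    and two: "\<And>x::'b. x + x = 0 \<Longrightarrow> x = 0"
  shows "c = 0"
proof -
  define h where "h = a - z * c"
  have a: "a = h + z * c" and d: "d = g - z * c"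
    using eigen(2) by (simp_all add: h_def algebra_simps)
  have b: "b = z * g - z * h - z * (z * c)"
    using eigen(1) by (simp add: a algebra_simps)
  have zc: "x * (z * y) = z * (x * y)" for x y
    by (metis central mult.assoc)
  \<comment> \<open>Commuting \<open>z\<close> to the front only past \<open>h\<close>, \<open>c\<close> and \<open>g\<close> keeps the rewriting terminating:
    the general rules would rewrite \<open>z * z\<close> to itself.\<close>
  note expand = a b d distrib_left distrib_right left_diff_distrib right_diff_distrib
    mult.assoc central [of h] central [of c] central [of g] zc [of h] zc [of c] zc [of g]
  have ch: "c * h = h * c + c * c"
    using rel(1) by (simp add: expand algebra_simps)
  have cg: "c * g = g * c + c * c"
    using rel(2) by (simp add: expand algebra_simps)
  have zch: "z * (c * h) = z * (h * c) + z * (c * c)" and zcg: "z * (c * g) = z * (g * c) + z * (c * c)"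
    by (simp_all add: ch cg distrib_left)
  have hc: "h * c + c * g = 0"
    using rel(6) by (simp add: expand zch zcg)
  have hg: "h * g - h * c = 1"
    using rel(7) by (simp add: expand zcg)
  have "g * h = h * g - h * c + g * c"
    using rel(5) by (simp add: expand zch zcg) (simp add: algebra_simps)
  then have gh: "g * h = 1 + g * c" by (simp add: hg)
  have "z * (g * h) - z * (h * g) = z * (g * c) - z * (h * c)"
    using arg_cong [OF gh, of "(*) z"] arg_cong [OF hg, of "(*) z"] by (simp add: algebra_simps)
  with rel(4) have "g * g = 1 + z * (h * c + c * g)"
    by (simp add: expand zch zcg) (simp add: algebra_simps)
  then have gg: "g * g = 1" by (simp add: hc)
  have "h - c = (g * g) * (h - c)" by (simp add: gg)
  also have "\<dots> = g * (g * h - g * c)" by (simp add: mult.assoc right_diff_distrib)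
  also have "\<dots> = g" by (simp add: gh)
  finally have c: "c = h - g" by (simp add: algebra_simps)
  have hh: "h * h = 1"
    using hc by (simp add: c gg algebra_simps)
  have "(h * g - 1) + (h * g - 1) = 0"
    using hg by (simp add: c hh algebra_simps)
  then have "h * g = 1" using two [of "h * g - 1"] by simp
  then have "h = g" using gg by (metis mult.assoc mult.left_neutral mult.right_neutral)
  then show ?thesis by (simp add: c)
qed


section \<open>Tensor products with a subspace\<close>

text \<open>
  A comodule carried by a proper subspace \<open>S\<close> of the Hopf algebra has its coaction in \<open>S \<otimes> H\<close>,
  whose elements are cosets smaller than those of \<open>H \<otimes> H\<close>.  The following lemmas compute with
  these cosets on representatives.
\<close>

lemma tcls_eq_of_diff:
  assumes "p - q \<in> tnull V W"
  shows "tcls V W p = tcls V W q"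
proof -
  have "r - p \<in> tnull V W \<longleftrightarrow> r - q \<in> tnull V W" for r
    using fscale.span_add_eq [OF assms [unfolded tnull_def], of "r - p"]
    by (simp add: tnull_def add.commute)
  then show ?thesis by (auto simp: tcls_def)
qed

lemma tcls3_eq_of_diff:
  assumes "p - q \<in> tnull3 U V W"
  shows "tcls3 U V W p = tcls3 U V W q"
proof -
  have "r - p \<in> tnull3 U V W \<longleftrightarrow> r - q \<in> tnull3 U V W" for r
    using fscale.span_add_eq [OF assms [unfolded tnull3_def], of "r - p"]
    by (simp add: tnull3_def add.commute)
  then show ?thesis by (auto simp: tcls3_def)
qed

lemma trep_tcls_supported:
  assumes "keys p \<subseteq> car V \<times> car W"
  shows "keys (trep (tcls V W p)) \<subseteq> car V \<times> car W" "trep (tcls V W p) - p \<in> tnull V W"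
proof -
  have "p \<in> tcls V W p"
    using assms by (simp add: tcls_def tnull_def fscale.span_zero)
  then have "trep (tcls V W p) \<in> tcls V W p"
    unfolding trep_def by (rule someI)
  then show "keys (trep (tcls V W p)) \<subseteq> car V \<times> car W" "trep (tcls V W p) - p \<in> tnull V W"
    by (simp_all add: tcls_def)
qed

lemma tadd_tcls:
  assumes "keys p \<subseteq> car V \<times> car W" "keys q \<subseteq> car V \<times> car W"
  shows "tadd V W (tcls V W p) (tcls V W q) = tcls V W (p + q)"
  unfolding tadd_def
proof (rule tcls_eq_of_diff)
  have "(trep (tcls V W p) - p) + (trep (tcls V W q) - q) \<in> tnull V W"
    using trep_tcls_supported(2) [OF assms(1)] trep_tcls_supported(2) [OF assms(2)]
    unfolding tnull_def by (rule fscale.span_add)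
  then show "trep (tcls V W p) + trep (tcls V W q) - (p + q) \<in> tnull V W"
    by (simp add: algebra_simps)
qed

lemma tscale_tcls:
  assumes "keys p \<subseteq> car V \<times> car W"
  shows "tscale V W c (tcls V W p) = tcls V W (fscale c p)"
  unfolding tscale_def
proof (rule tcls_eq_of_diff)
  have "fscale c (trep (tcls V W p) - p) \<in> tnull V W"
    using trep_tcls_supported(2) [OF assms] unfolding tnull_def by (rule fscale.span_scale)
  then show "fscale c (trep (tcls V W p)) - fscale c p \<in> tnull V W"
    by (simp add: fscale.scale_right_diff_distrib)
qed

lemma tnull_subspace_mono:
  fixes s1 :: "'k::field \<Rightarrow> 'v::ab_group_add \<Rightarrow> 'v" and s2 :: "'k \<Rightarrow> 'w::ab_group_add \<Rightarrow> 'w"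
  shows "tnull \<lparr>car = S, scl = s1\<rparr> (uvs s2) \<subseteq> tnull (uvs s1) (uvs s2)"
proof -
  have "slot_relations \<lparr>car = S, scl = s1\<rparr> e \<subseteq> slot_relations (uvs s1) e" for e :: "'v \<Rightarrow> 'v \<times> 'w"
    by (auto simp: slot_relations_def)
  then show ?thesis
    unfolding tnull_def by (intro fscale.span_mono Un_mono UN_mono) auto
qed

lemma (in vector_space) tlift_tcls_subspace:
  assumes "bilin s1 s2 scale f" "keys p \<subseteq> S \<times> UNIV"
  shows "tlift scale f (tcls \<lparr>car = S, scl = s1\<rparr> (uvs s2) p) = linext scale (\<lambda>(x, y). f x y) p"
  using linext_tnull [OF assms(1) subsetD [OF tnull_subspace_mono trep_tcls_supported(2)]] assms(2)
  by (simp add: tlift_def linext_diff)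

lemma lin_id_on:
  assumes "\<And>i. i \<in> keys p \<Longrightarrow> f i = single i 1"
  shows "lin f p = p"
proof -
  have "lin f p = (\<Sum>i\<in>keys p. single i (lookup p i))"
    unfolding linext_def by (rule sum.cong) (simp_all add: assms)
  then show ?thesis by (simp add: sum_single)
qed

text \<open>
  A linear map that changes a single tensor factor by \<open>Q\<close> sends the linearity relations of that
  factor to linearity relations.  With \<open>Q\<close> a projection onto \<open>S\<close>, relations over the whole space
  become relations over \<open>S\<close>.
\<close>

lemma lin_slot_relations:
  assumes "r \<in> slot_relations (uvs s) e"
    and "\<And>x. F (e x) = single (e' (Q x)) 1"
    and "\<And>x y. Q (x + y) = Q x + Q y" "\<And>c x. Q (s c x) = s c (Q x)" "\<And>x. Q x \<in> S"
  shows "lin F r \<in> slot_relations \<lparr>car = S, scl = s\<rparr> e'"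
  using assms(1)
proof (cases rule: slot_relations_uvs_E)
  case (add x y)
  then show ?thesis
    using assms(5) [of x] assms(5) [of y]
    by (auto simp: slot_relations_def fscale.linext_diff assms(2-4))
next
  case (scale c x)
  then show ?thesis
    using assms(5) [of x]
    by (auto simp: slot_relations_def fscale.linext_diff assms(2-4))
qed

text \<open>
  Tensoring preserves the injectivity of \<open>S \<rightarrow> V\<close>, because a projection \<open>P\<close> onto \<open>S\<close> induces a
  left inverse: \<open>P \<otimes> id \<otimes> id\<close> fixes \<open>p\<close> and carries the relations over \<open>V\<close> to relations over \<open>S\<close>.
\<close>

lemma tnull3_retract:
  fixes p :: "'v::ab_group_add \<times> 'w::ab_group_add \<times> 'x::ab_group_add \<Rightarrow>\<^sub>0 'k::field"
  assumes P: "\<And>x y. P (x + y) = P x + P y" "\<And>c x. P (s1 c x) = s1 c (P x)"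
    and S: "\<And>x. P x \<in> S" "\<And>x. x \<in> S \<Longrightarrow> P x = x"
    and p: "keys p \<subseteq> S \<times> UNIV \<times> UNIV" "p \<in> tnull3 (uvs s1) (uvs s2) (uvs s3)"
  shows "p \<in> tnull3 \<lparr>car = S, scl = s1\<rparr> (uvs s2) (uvs s3)"
proof -
  let ?T = "lin (\<lambda>(x, y, z). single (P x, y, z) (1::'k))"
  interpret T: Vector_Spaces.linear fscale fscale ?T by (rule fscale.linext_linear)
  have "?T r \<in> tnull3 \<lparr>car = S, scl = s1\<rparr> (uvs s2) (uvs s3)"
    if "r \<in> tnull3 (uvs s1) (uvs s2) (uvs s3)" for r
    using that unfolding tnull3_def
  proof (induction rule: fscale.span_induct_alt)
    case base
    then show ?case by (simp add: fscale.span_zero)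
  next
    case (step c r r')
    from step(1) consider
      (fst) y z where "r \<in> slot_relations (uvs s1) (\<lambda>x. (x, y, z))"
      | (snd) x z where "r \<in> slot_relations (uvs s2) (\<lambda>y. (x, y, z))"
      | (thd) x y where "r \<in> slot_relations (uvs s3) (\<lambda>z. (x, y, z))"
      by auto
    then have "?T r \<in> (\<Union>y\<in>car (uvs s2). \<Union>z\<in>car (uvs s3). slot_relations \<lparr>car = S, scl = s1\<rparr> (\<lambda>x. (x, y, z)))
      \<union> (\<Union>x\<in>S. \<Union>z\<in>car (uvs s3). slot_relations (uvs s2) (\<lambda>y. (x, y, z)))
      \<union> (\<Union>x\<in>S. \<Union>y\<in>car (uvs s2). slot_relations (uvs s3) (\<lambda>z. (x, y, z)))"
    proof cases
      case fst
      then have "?T r \<in> slot_relations \<lparr>car = S, scl = s1\<rparr> (\<lambda>x. (x, y, z))"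
        by (rule lin_slot_relations [where Q = P]) (simp_all add: P S(1))
      then show ?thesis by auto
    next
      case snd
      then have "?T r \<in> slot_relations (uvs s2) (\<lambda>y. (P x, y, z))"
        by (rule lin_slot_relations [where Q = "\<lambda>x. x"]) simp_all
      then show ?thesis using S(1) by auto
    next
      case thd
      then have "?T r \<in> slot_relations (uvs s3) (\<lambda>z. (P x, y, z))"
        by (rule lin_slot_relations [where Q = "\<lambda>x. x"]) simp_all
      then show ?thesis using S(1) by auto
    qed
    then show ?case
      unfolding T.add T.scale
      by (intro fscale.span_add fscale.span_scale fscale.span_base step(2)) simp
  qed
  moreover have "?T p = p"
    by (rule lin_id_on) (use p(1) S(2) in auto)
  ultimately show ?thesis using p(2) by metis
qed

text \<open>
  Thus equality in \<open>S \<otimes> W \<otimes> X\<close> can be tested with trilinear forms on the ambient spaces, for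
  which the values of the structure maps on representatives are easy to compute.
\<close>

lemma tcls3_eqI_retract:
  fixes p q :: "'v::ab_group_add \<times> 'w::ab_group_add \<times> 'x::ab_group_add \<Rightarrow>\<^sub>0 'k::field"
  assumes P: "\<And>x y. P (x + y) = P x + P y" "\<And>c x. P (s1 c x) = s1 c (P x)"
    and S: "\<And>x. P x \<in> S" "\<And>x. x \<in> S \<Longrightarrow> P x = x"
    and supp: "keys p \<subseteq> S \<times> UNIV \<times> UNIV" "keys q \<subseteq> S \<times> UNIV \<times> UNIV"
    and eq: "\<And>f. trilin s1 s2 s3 (*) f \<Longrightarrow>
      linext (*) (\<lambda>(x, y, z). f x y z) p = linext (*) (\<lambda>(x, y, z). f x y z) q"
  shows "tcls3 \<lparr>car = S, scl = s1\<rparr> (uvs s2) (uvs s3) p = tcls3 \<lparr>car = S, scl = s1\<rparr> (uvs s2) (uvs s3) q"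
proof (rule tcls3_eq_of_diff, rule tnull3_retract [where P = P])
  show "keys (p - q) \<subseteq> S \<times> UNIV \<times> UNIV"
    using supp keys_diff [of p q] by blast
  show "p - q \<in> tnull3 (uvs s1) (uvs s2) (uvs s3)"
    by (rule tnull3I) (simp add: kext_diff eq)
qed (fact P S)+

lemma keys_lin_subset:
  assumes "\<And>i. i \<in> keys p \<Longrightarrow> keys (f i) \<subseteq> A"
  shows "keys (lin f p) \<subseteq> A"
proof
  fix j assume "j \<in> keys (lin f p)"
  then have "lookup (lin f p) j \<noteq> 0" by (simp add: in_keys_iff)
  then have "(\<Sum>i\<in>keys p. lookup p i * lookup (f i) j) \<noteq> 0"
    by (simp add: linext_def lookup_sum)
  then obtain i where "i \<in> keys p" "lookup (f i) j \<noteq> 0"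
    by (metis (mono_tags, lifting) mult_zero_right sum.neutral)
  then show "j \<in> A" using assms [of i] by (auto simp: in_keys_iff)
qed


section \<open>Invariant lines of multiplicative matrices\<close>

definition multiplicative_matrix2 ::
  "('k::field, 'a::ring_1) hopf \<Rightarrow> 'a \<Rightarrow> 'a \<Rightarrow> 'a \<Rightarrow> 'a \<Rightarrow> bool" where
  "multiplicative_matrix2 H p q r s \<longleftrightarrow>
     comult H p = tcls (hvs H) (hvs H) (single (p, p) 1 + single (q, r) 1)
   \<and> comult H q = tcls (hvs H) (hvs H) (single (p, q) 1 + single (q, s) 1)
   \<and> comult H r = tcls (hvs H) (hvs H) (single (r, p) 1 + single (s, r) 1)
   \<and> comult H s = tcls (hvs H) (hvs H) (single (r, q) 1 + single (s, s) 1)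
   \<and> counit H p = 1 \<and> counit H q = 0 \<and> counit H r = 0 \<and> counit H s = 1"

context hopf_algebra
begin

lemma tlift_comult_linear:
  assumes "bilin (hscale H) (hscale H) (*) f"
  shows "tlift (*) f (comult H (x + y)) = tlift (*) f (comult H x) + tlift (*) f (comult H y)"
    "tlift (*) f (comult H (hscale H c x)) = c * tlift (*) f (comult H x)"
  by (simp_all only: comult_add comult_scale tlift_tops [OF assms])

end

text \<open>
  The first row \<open>p, q\<close> of a multiplicative matrix spans a right comodule, since
  \<open>\<Delta>(p) = p \<otimes> p + q \<otimes> r\<close> and \<open>\<Delta>(q) = p \<otimes> q + q \<otimes> s\<close>.  The linear forms \<open>\<alpha>\<close> and \<open>\<beta>\<close> on the
  Hopf algebra express that \<open>p\<close> and \<open>q\<close> are linearly independent: on their span they are the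
  coordinates, and together they give the projection \<open>row_proj\<close> onto it.
\<close>

context
  fixes H :: "('k::field, 'a::ring_1) hopf" and p q r s :: 'a and \<alpha> \<beta> :: "'a \<Rightarrow> 'k"
  assumes hopf: "hopf_algebra H"
    and mat: "multiplicative_matrix2 H p q r s"
    and \<alpha>: "Vector_Spaces.linear (hscale H) (*) \<alpha>" "\<alpha> p = 1" "\<alpha> q = 0"
    and \<beta>: "Vector_Spaces.linear (hscale H) (*) \<beta>" "\<beta> p = 0" "\<beta> q = 1"
begin

interpretation hopf_algebra H by (fact hopf)
interpretation \<alpha>: Vector_Spaces.linear "hscale H" "(*)" \<alpha> by (fact \<alpha>)
interpretation \<beta>: Vector_Spaces.linear "hscale H" "(*)" \<beta> by (fact \<beta>)

definition row_proj :: "'a \<Rightarrow> 'a" where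
  "row_proj v = hscale H (\<alpha> v) p + hscale H (\<beta> v) q"

definition row_span :: "'a set" where
  "row_span = range row_proj"

abbreviation row_vs :: "('k, 'a) vspace" where
  "row_vs \<equiv> \<lparr>car = row_span, scl = hscale H\<rparr>"

definition row_rep :: "'a \<Rightarrow> ('a \<times> 'a \<Rightarrow>\<^sub>0 'k)" where
  "row_rep v = fscale (\<alpha> v) (single (p, p) 1 + single (q, r) 1)
             + fscale (\<beta> v) (single (p, q) 1 + single (q, s) 1)"

definition row_coaction :: "'a \<Rightarrow> ('a \<times> 'a \<Rightarrow>\<^sub>0 'k) set" where
  "row_coaction v = tcls row_vs (hvs H) (row_rep v)"

lemma row_proj_linear:
  "row_proj (x + y) = row_proj x + row_proj y" "row_proj (hscale H c x) = hscale H c (row_proj x)"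
  by (simp_all add: row_proj_def \<alpha>.add \<beta>.add \<alpha>.scale \<beta>.scale scale_left_distrib scale_right_distrib)

lemma row_coords: "\<alpha> (row_proj v) = \<alpha> v" "\<beta> (row_proj v) = \<beta> v"
  by (simp_all add: row_proj_def \<alpha>.add \<beta>.add \<alpha>.scale \<beta>.scale \<alpha>(2,3) \<beta>(2,3))

lemma row_proj_in [simp]: "row_proj v \<in> row_span"
  by (simp add: row_span_def)

lemma row_proj_id: "v \<in> row_span \<Longrightarrow> row_proj v = v"
  by (auto simp: row_span_def row_proj_def row_coords [unfolded row_proj_def])

lemma row_mem: "p \<in> row_span" "q \<in> row_span"
  using row_proj_in [of p] row_proj_in [of q] by (simp_all add: row_proj_def \<alpha>(2,3) \<beta>(2,3))

lemma subspace_row_span: "subspace row_span"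
  unfolding subspace_def
proof (intro conjI allI ballI)
  show "0 \<in> row_span" using row_proj_in [of 0] by (simp add: row_proj_def \<alpha>.zero \<beta>.zero)
  show "x + y \<in> row_span" if "x \<in> row_span" "y \<in> row_span" for x y
    using row_proj_in [of "x + y"] that by (simp add: row_proj_linear row_proj_id)
  show "hscale H c x \<in> row_span" if "x \<in> row_span" for c x
    using row_proj_in [of "hscale H c x"] that by (simp add: row_proj_linear row_proj_id)
qed

lemma keys_row_rep: "keys (row_rep v) \<subseteq> row_span \<times> UNIV"
proof
  fix i assume "i \<in> keys (row_rep v)"
  then have "i \<in> {(p, p), (q, r), (p, q), (q, s)}"
    by (auto simp: row_rep_def in_keys_iff lookup_add lookup_single when_def split: if_splits)
  then show "i \<in> row_span \<times> UNIV" using row_mem by auto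
qed

lemma keys_trep_row: "keys (trep (row_coaction v)) \<subseteq> row_span \<times> UNIV"
  using trep_tcls_supported(1) [of "row_rep v" row_vs "hvs H"] keys_row_rep [of v]
  by (simp add: row_coaction_def)

lemma linext_row_rep:
  assumes "vector_space sc"
  shows "linext sc (\<lambda>(x, y). f x y) (row_rep v) =
    sc (\<alpha> v) (f p p + f q r) + sc (\<beta> v) (f p q + f q s)"
  by (simp add: row_rep_def vector_space.linext_add [OF assms] vector_space.linext_fscale [OF assms]
      vector_space.linext_single [OF assms] vector_space.vector_space_assms(4) [OF assms])

lemma tlift_row:
  assumes "vector_space sc" "bilin (hscale H) (hscale H) sc f"
  shows "tlift sc f (row_coaction v) = sc (\<alpha> v) (f p p + f q r) + sc (\<beta> v) (f p q + f q s)"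
  using vector_space.tlift_tcls_subspace [OF assms keys_row_rep, of v] linext_row_rep [OF assms(1), of f v]
  by (simp add: row_coaction_def)

lemmas klift_row = tlift_row [OF vector_space_times]

lemma klift_comult_matrix:
  assumes "bilin (hscale H) (hscale H) (*) f"
  shows "tlift (*) f (comult H p) = f p p + f q r" "tlift (*) f (comult H q) = f p q + f q s"
    "tlift (*) f (comult H r) = f r p + f s r" "tlift (*) f (comult H s) = f r q + f s s"
  using mat by (simp_all add: multiplicative_matrix2_def kext_add kext_single
      vector_space.tlift_tcls [OF vector_space_times assms])

text \<open>
  On \<open>p\<close> and on \<open>q\<close>, both sides are \<open>f\<close> applied to an entry of the product
  \<open>M \<otimes> M \<otimes> M\<close> of three copies of the matrix, bracketed in the two possible ways.
\<close>

lemma row_coassoc_form: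
  assumes f: "trilin (hscale H) (hscale H) (hscale H) (*) f"
  shows "tlift (*) (\<lambda>x z. tlift (*) (\<lambda>u w. f u w z) (row_coaction x)) (row_coaction v) =
         tlift (*) (\<lambda>u x. tlift (*) (\<lambda>w z. f u w z) (comult H x)) (row_coaction v)"
proof -
  have f1: "bilin (hscale H) (hscale H) (*) (f x)"
    and f3: "bilin (hscale H) (hscale H) (*) (\<lambda>x y. f x y z)" for x z
    using f by (auto simp: trilin_def)
  have row: "tlift (*) (\<lambda>u w. f u w z) (row_coaction x) =
      \<alpha> x * (f p p z + f q r z) + \<beta> x * (f p q z + f q s z)" for x z
    by (rule klift_row [OF f3])
  have l: "bilin (hscale H) (hscale H) (*) (\<lambda>x z. tlift (*) (\<lambda>u w. f u w z) (row_coaction x))"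
    unfolding row bilin_def \<alpha>.add \<beta>.add \<alpha>.scale \<beta>.scale bilinD(3,4) [OF f1]
    by (simp only: algebra_simps simp_thms)
  have r: "bilin (hscale H) (hscale H) (*) (\<lambda>u x. tlift (*) (f u) (comult H x))"
  proof -
    have "f (x + x') = (\<lambda>y z. f x y z + f x' y z)" "f (hscale H c x) = (\<lambda>y z. c * f x y z)" for x x' c
      by (simp_all add: fun_eq_iff bilinD(1,2) [OF f3])
    then show ?thesis
      by (simp add: bilin_def tlift_comult_linear [OF f1] klift_fun)
  qed
  show ?thesis
    unfolding row klift_row [OF l, unfolded row] klift_row [OF r] klift_comult_matrix [OF f1]
    by (simp add: \<alpha>(2,3) \<beta>(2,3) add_ac)
qed

lemma row_comodule: "comodule H row_vs row_coaction"
  unfolding comodule_def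
proof (intro conjI ballI allI)
  show "is_vspace row_vs"
    using subspace_row_span by (simp add: is_vspace_def vector_space_axioms)
next
  fix v w c assume "v \<in> car row_vs"
  then have v: "row_proj v = v" by (simp add: row_proj_id)
  show "row_coaction v \<in> tprod row_vs (hvs H)"
    using keys_row_rep by (auto simp: tprod_def row_coaction_def)
  show "row_coaction (v + w) = tadd row_vs (hvs H) (row_coaction v) (row_coaction w)"
  proof -
    have "row_rep (v + w) = row_rep v + row_rep w"
      by (simp add: row_rep_def \<alpha>.add \<beta>.add fscale.scale_left_distrib)
    then show ?thesis
      using keys_row_rep by (simp add: row_coaction_def tadd_tcls)
  qed
  show "row_coaction (scl row_vs c v) = tscale row_vs (hvs H) c (row_coaction v)"
  proof -
    have "row_rep (hscale H c v) = fscale c (row_rep v)"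
      by (simp add: row_rep_def \<alpha>.scale \<beta>.scale fscale.scale_right_distrib)
    then show ?thesis
      using keys_row_rep by (simp add: row_coaction_def tscale_tcls)
  qed
  show "tmap_left row_vs (hvs H) (hvs H) row_coaction (row_coaction v) =
      tmap_right row_vs (hvs H) (hvs H) (comult H) (row_coaction v)"
    unfolding tmap_left_def tmap_right_def
  proof (rule tcls3_eqI_retract [where P = row_proj])
    show "keys (lin (\<lambda>(x, z). lin (\<lambda>(u, v). single (u, v, z) 1) (trep (row_coaction x)))
        (trep (row_coaction v))) \<subseteq> row_span \<times> UNIV \<times> UNIV"
      using keys_trep_row by (fastforce intro!: keys_lin_subset)
    show "keys (lin (\<lambda>(u, x). lin (\<lambda>(v, w). single (u, v, w) 1) (trep (comult H x)))
        (trep (row_coaction v))) \<subseteq> row_span \<times> UNIV \<times> UNIV"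
      using keys_trep_row by (fastforce intro!: keys_lin_subset)
    fix f :: "'a \<Rightarrow> 'a \<Rightarrow> 'a \<Rightarrow> 'k"
    assume "trilin (hscale H) (hscale H) (hscale H) (*) f"
    from row_coassoc_form [OF this, of v] show
      "linext (*) (\<lambda>(x, y, z). f x y z) (lin (\<lambda>(x, z). lin (\<lambda>(u, v). single (u, v, z) 1)
         (trep (row_coaction x))) (trep (row_coaction v))) =
       linext (*) (\<lambda>(x, y, z). f x y z) (lin (\<lambda>(u, x). lin (\<lambda>(v, w). single (u, v, w) 1)
         (trep (comult H x))) (trep (row_coaction v)))"
      by (simp add: kext_lin kext_single tlift_def case_prod_unfold)
  qed (simp_all add: row_proj_linear row_proj_id)
  have "bilin (hscale H) (hscale H) (hscale H) (\<lambda>w x. hscale H (counit H x) w)"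
    by (simp add: bilin_def counit_add counit_scale scale_left_distrib scale_right_distrib mult.commute)
  then have "tlift (hscale H) (\<lambda>w x. hscale H (counit H x) w) (row_coaction v) = row_proj v"
    using mat by (simp add: tlift_row vector_space_axioms row_proj_def multiplicative_matrix2_def)
  then show "tlift (scl row_vs) (\<lambda>w x. scl row_vs (counit H x) w) (row_coaction v) = v"
    by (simp add: v)
qed

text \<open>
  A proper nonzero subcomodule is a line spanned by some \<open>u = x p + y q\<close>.  Its coaction has the form
  \<open>u \<otimes> g\<close>; comparing with \<open>p \<otimes> (x p + y q) + q \<otimes> (x r + y s)\<close> shows that \<open>(x, y)\<close> is an
  eigenvector of the matrix with eigenvalue \<open>g\<close>.  The conclusion is this property with \<open>g\<close>
  eliminated: \<open>x p + y q\<close> and \<open>x r + y s\<close> are in the ratio \<open>x : y\<close>.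
\<close>

lemma row_subcomodule_invariant:
  assumes U: "subcomodule H row_vs row_coaction U" "U \<noteq> {0}" "U \<noteq> row_span"
  obtains x y where "x \<noteq> 0 \<or> y \<noteq> 0"
    "hscale H y (hscale H x p + hscale H y q) = hscale H x (hscale H x r + hscale H y s)"
proof -
  have sub: "subspace U" "U \<subseteq> row_span"
    using U(1) by (auto simp: subcomodule_def)
  then obtain u where u: "u \<in> U" "u \<noteq> 0"
    using U(2) subspace_0 by blast
  define x y where "x = \<alpha> u" and "y = \<beta> u"
  have u_eq: "u = hscale H x p + hscale H y q"
    using row_proj_id [of u] u(1) sub(2) by (auto simp: row_proj_def x_def y_def)
  \<comment> \<open>The form \<open>\<phi>\<close> cuts out the line of \<open>u\<close>; applied to the left factor it detects that the
    coaction of \<open>u\<close> stays in this line.\<close>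
  define \<phi> where "\<phi> v = y * \<alpha> v - x * \<beta> v" for v
  have \<phi>_linear: "\<phi> (v + w) = \<phi> v + \<phi> w" "\<phi> (hscale H c v) = c * \<phi> v" for v w c
    unfolding \<phi>_def \<alpha>.add \<beta>.add \<alpha>.scale \<beta>.scale by (simp_all only: algebra_simps)
  have \<phi>0: "\<phi> v = 0" if v: "v \<in> U" for v
  proof (rule ccontr)
    assume "\<phi> v \<noteq> 0"
    have v_eq: "v = hscale H (\<alpha> v) p + hscale H (\<beta> v) q"
      using row_proj_id [of v] v sub(2) by (auto simp: row_proj_def)
    \<comment> \<open>Cramer's rule: \<open>\<phi> v\<close> is the determinant of the coordinates of \<open>u\<close> and \<open>v\<close>.\<close>
    have "hscale H y v - hscale H (\<beta> v) u = hscale H (\<phi> v) p"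
      by (subst v_eq, subst u_eq)
         (simp add: \<phi>_def scale_right_distrib scale_left_diff_distrib algebra_simps)
    moreover have "hscale H (\<alpha> v) u - hscale H x v = hscale H (\<phi> v) q"
      by (subst (2) v_eq, subst u_eq)
         (simp add: \<phi>_def scale_right_distrib scale_left_diff_distrib algebra_simps)
    ultimately have "hscale H (\<phi> v) p \<in> U" "hscale H (\<phi> v) q \<in> U"
      using u(1) v sub(1) by (metis subspace_diff subspace_scale)+
    then have "hscale H (inverse (\<phi> v)) (hscale H (\<phi> v) p) \<in> U"
        "hscale H (inverse (\<phi> v)) (hscale H (\<phi> v) q) \<in> U"
      using sub(1) subspace_scale by blast+
    then have "p \<in> U" "q \<in> U" using \<open>\<phi> v \<noteq> 0\<close> by simp_all
    then have "row_span \<subseteq> U"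
      using sub(1) by (auto simp: row_span_def row_proj_def intro!: subspace_add subspace_scale)
    then show False using sub(2) U(3) by blast
  qed
  obtain t where t: "keys t \<subseteq> U \<times> UNIV" "row_coaction u = tcls row_vs (hvs H) t"
    using U(1) u(1) by (auto simp: subcomodule_def)
  have bil: "bilin (hscale H) (hscale H) (hscale H) (\<lambda>v w. hscale H (\<phi> v) w)"
    by (simp add: bilin_def \<phi>_linear scale_left_distrib scale_right_distrib mult.commute)
  have "tlift (hscale H) (\<lambda>v w. hscale H (\<phi> v) w) (row_coaction u) =
      linext (hscale H) (\<lambda>(v, w). hscale H (\<phi> v) w) t"
    unfolding t(2) by (rule tlift_tcls_subspace [OF bil]) (use t(1) sub(2) in blast)
  also have "\<dots> = 0"
    unfolding linext_def using t(1) \<phi>0 by (auto intro!: sum.neutral)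
  also have "tlift (hscale H) (\<lambda>v w. hscale H (\<phi> v) w) (row_coaction u) =
      hscale H x (hscale H y p - hscale H x r) + hscale H y (hscale H y q - hscale H x s)"
    unfolding tlift_row [OF vector_space_axioms bil] by (simp add: \<phi>_def \<alpha>(2,3) \<beta>(2,3) x_def y_def)
  finally have "hscale H y (hscale H x p + hscale H y q) = hscale H x (hscale H x r + hscale H y s)"
    by (simp add: scale_right_distrib scale_right_diff_distrib algebra_simps)
  moreover have "x \<noteq> 0 \<or> y \<noteq> 0" using u(2) u_eq by auto
  ultimately show ?thesis using that by blast
qed

lemma pointed_row_invariant:
  assumes "pointed H"
  shows "\<exists>x y. (x \<noteq> 0 \<or> y \<noteq> 0) \<and>
    hscale H y (hscale H x p + hscale H y q) = hscale H x (hscale H x r + hscale H y s)"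
proof (rule ccontr)
  assume no_line: "\<not> ?thesis"
  have "U = {0} \<or> U = row_span" if "subcomodule H row_vs row_coaction U" for U
    using row_subcomodule_invariant [OF that] no_line by metis
  moreover have "p \<noteq> 0" using \<alpha>(2) \<alpha>.zero by auto
  then have "row_span \<noteq> {0}" using row_mem by auto
  ultimately have "simple_comodule H row_vs row_coaction"
    using row_comodule by (simp add: simple_comodule_def)
  then have "dim row_span = 1"
    using assms unfolding pointed_def by blast
  moreover have "row_span = span {p, q}"
  proof
    show "row_span \<subseteq> span {p, q}"
      by (auto simp: row_span_def row_proj_def intro!: span_add span_scale intro: span_base)
    show "span {p, q} \<subseteq> row_span"
      by (rule span_minimal) (use row_mem subspace_row_span in auto)
  qed
  moreover have "independent {p, q}"
  proof -
    have "\<alpha> v = 0" if "v \<in> span {q}" for v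
      by (rule \<alpha>.eq_0_on_span [OF _ that]) (use \<alpha>(3) in auto)
    then have "p \<notin> span {q}" using \<alpha>(2) by fastforce
    moreover have "q \<noteq> 0" using \<beta>(3) \<beta>.zero by auto
    ultimately show ?thesis by (simp add: independent_insert)
  qed
  moreover have "p \<noteq> q" using \<alpha>(2,3) by auto
  ultimately show False using dim_span_eq_card_independent [of "{p, q}"] by simp
qed

end

text \<open>
  If the first row is linearly dependent, then \<open>\<epsilon>(p) = 1\<close> and \<open>\<epsilon>(q) = 0\<close> force \<open>q = 0\<close>, and
  \<open>(0, 1)\<close> is an eigenvector.  Otherwise the first row spans a two-dimensional comodule, which is
  not simple over a pointed Hopf algebra.
\<close>

lemma pointed_imp_invariant_line:
  assumes "hopf_algebra H" "pointed H" "multiplicative_matrix2 H p q r s"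
  shows "\<exists>x y. (x \<noteq> 0 \<or> y \<noteq> 0) \<and>
    hscale H y (hscale H x p + hscale H y q) = hscale H x (hscale H x r + hscale H y s)"
proof -
  interpret hopf_algebra H by fact
  interpret forms: vector_space_pair "hscale H" "(*)"
    by (intro vector_space_pair.intro vector_space_axioms vector_space_times)
  show ?thesis
  proof (cases "q = 0")
    case True
    then show ?thesis by (intro exI [of _ 0] exI [of _ 1]) simp
  next
    case False
    have eps: "counit H p = 1" "counit H q = 0"
      using assms(3) by (simp_all add: multiplicative_matrix2_def)
    then have "p \<notin> span {q}"
      by (auto simp: span_singleton counit_scale)
    with False have ind: "independent {p, q}" and neq: "p \<noteq> q"
      by (auto simp: independent_insert span_base)
    obtain \<alpha> where "Vector_Spaces.linear (hscale H) (*) \<alpha>" "\<forall>v\<in>{p, q}. \<alpha> v = (if v = p then 1 else 0)"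
      using forms.linear_independent_extend [OF ind, of "\<lambda>v. if v = p then 1 else 0"] by blast
    moreover obtain \<beta> where "Vector_Spaces.linear (hscale H) (*) \<beta>" "\<forall>v\<in>{p, q}. \<beta> v = (if v = q then 1 else 0)"
      using forms.linear_independent_extend [OF ind, of "\<lambda>v. if v = q then 1 else 0"] by blast
    ultimately show ?thesis
      using pointed_row_invariant [OF assms(1,3), of \<alpha> \<beta>] assms(2) neq by simp
  qed
qed


section \<open>Pointed quotients of the Jordanian quantum \<open>SL(2)\<close>\<close>

lemma bilin_comp_linear:
  assumes "bilin s1' s2' s f" "Vector_Spaces.linear s1 s1' F" "Vector_Spaces.linear s2 s2' G"
  shows "bilin s1 s2 s (\<lambda>x y. f (F x) (G y))"
proof -
  interpret F: Vector_Spaces.linear s1 s1' F by fact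
  interpret G: Vector_Spaces.linear s2 s2' G by fact
  show ?thesis by (simp add: bilin_def F.add F.scale G.add G.scale bilinD(1-4) [OF assms(1)])
qed

text \<open>
  The comultiplication of an element of the Jordanian \<open>SL(2)\<close> is a coset of which only some
  unspecified representative enters into \<open>F \<otimes> G\<close>; on \<open>0\<close> and on the generators the explicit
  representatives give the same result.
\<close>

lemma tmap_comult_sl2j:
  fixes B :: "('k::field, 'b::ring_1) hopf" and B' :: "('k, 'c::ring_1) hopf"
  assumes lin: "Vector_Spaces.linear sl2j_scale (hscale B) F" "Vector_Spaces.linear sl2j_scale (hscale B') G"
  shows "tmap (hvs B) (hvs B') F G (comult sl2j 0) = tcls (hvs B) (hvs B') 0"
    and "tmap (hvs B) (hvs B') F G (comult sl2j (sl2j_gen g)) =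
      tcls (hvs B) (hvs B') (lin (\<lambda>(x, y). single (F x, G y) 1) (comult_gen g))"
proof -
  have eval: "linext (*) (\<lambda>(x, y). f x y) (lin (\<lambda>(x, y). single (F x, G y) 1) p) =
      linext (*) (\<lambda>(x, y). f (F x) (G y)) p" for f :: "'b \<Rightarrow> 'c \<Rightarrow> 'k" and p
    by (simp add: kext_lin kext_single case_prod_unfold)
  note bil = bilin_comp_linear [OF _ lin]
  show "tmap (hvs B) (hvs B') F G (comult sl2j 0) = tcls (hvs B) (hvs B') 0"
    unfolding tmap_def
    by (rule tcls_eqI) (simp only: eval klift_comult(1) [OF bil, unfolded tlift_def] kext_zero)
  show "tmap (hvs B) (hvs B') F G (comult sl2j (sl2j_gen g)) =
      tcls (hvs B) (hvs B') (lin (\<lambda>(x, y). single (F x, G y) 1) (comult_gen g))"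
    unfolding tmap_def
    by (rule tcls_eqI) (simp only: eval klift_comult(6) [OF bil, unfolded tlift_def])
qed

lemma hopf_hom_sl2j_matrix:
  assumes "hopf_hom sl2j B \<pi>"
  shows "multiplicative_matrix2 B (\<pi> (sl2j_gen Ga)) (\<pi> (sl2j_gen Gb)) (\<pi> (sl2j_gen Gc)) (\<pi> (sl2j_gen Gd))"
proof -
  have lin: "Vector_Spaces.linear sl2j_scale (hscale B) \<pi>"
    and comult: "\<And>x. comult B (\<pi> x) = tmap (hvs B) (hvs B) \<pi> \<pi> (comult sl2j x)"
    and counit: "\<And>x. counit B (\<pi> x) = counit sl2j x"
    using assms by (auto simp: hopf_hom_def)
  show ?thesis
    unfolding multiplicative_matrix2_def comult counit tmap_comult_sl2j(2) [OF lin lin]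
    by (simp add: counit_sl2j_gen counit_gen_def comult_gen_def Let_def fscale.linext_add)
qed

lemma two_neq_0_of_CHAR:
  assumes "CHAR('k::field) \<noteq> 2"
  shows "(2::'k) \<noteq> 0"
proof
  assume "(2::'k) = 0"
  then have "of_nat 2 = (0::'k)" by simp
  then have "CHAR('k) dvd 2" by (simp only: of_nat_eq_0_iff_char_dvd)
  then have "CHAR('k) \<le> 2" "CHAR('k) \<noteq> 0" by (auto intro: dvd_imp_le gr0I)
  moreover have "CHAR('k) \<noteq> 1" by simp
  ultimately show False using assms by linarith
qed

text \<open>
  An invariant line other than the one spanned by \<open>(1, 0)\<close> is spanned by \<open>(x / y, 1)\<close>, which is
  the normalisation used in \<open>jordanian_eigenvector_imp_c_eq_0\<close>.
\<close>

lemma pointed_quotient_c_eq_0: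
  fixes B :: "('k::field, 'b::ring_1) hopf"
  assumes "CHAR('k) \<noteq> 2" "hopf_algebra B" "pointed B" "hopf_hom sl2j B \<pi>"
  shows "\<pi> (sl2j_gen Gc) = 0"
proof -
  interpret hopf_algebra B by fact
  define a b c d where "a = \<pi> (sl2j_gen Ga)" and "b = \<pi> (sl2j_gen Gb)"
    and "c = \<pi> (sl2j_gen Gc)" and "d = \<pi> (sl2j_gen Gd)"
  interpret \<pi>: Vector_Spaces.linear sl2j_scale "hscale B" \<pi>
    using assms(4) by (simp add: hopf_hom_def)
  have hom: "\<pi> 1 = 1" "\<And>x y. \<pi> (x * y) = \<pi> x * \<pi> y"
    using assms(4) by (auto simp: hopf_hom_def)
  note rel = sl2j_gen_relations [where 'a = 'k, THEN arg_cong [where f = \<pi>],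
      unfolded \<pi>.diff \<pi>.add hom, folded a_def b_def c_def d_def]
  obtain x y where xy: "x \<noteq> 0 \<or> y \<noteq> 0"
    and line: "hscale B y (hscale B x a + hscale B y b) = hscale B x (hscale B x c + hscale B y d)"
    using pointed_imp_invariant_line [OF assms(2,3) hopf_hom_sl2j_matrix [OF assms(4)]]
    unfolding a_def b_def c_def d_def by blast
  have "c = 0"
  proof (cases "y = 0")
    case True
    then show ?thesis using xy line by simp
  next
    case False
    define z where "z = hscale B (x / y) 1"
    have z: "u * z = hscale B (x / y) u" "z * u = hscale B (x / y) u" for u
      unfolding z_def scale_mult_left [symmetric] scale_mult_right [symmetric] by simp_all
    show ?thesis
    proof (rule jordanian_eigenvector_imp_c_eq_0 [OF rel])
      show "u * z = z * u" for u by (simp add: z)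
      show "z * c + d = z * c + d" ..
      have "hscale B (x / y) a + b = hscale B (1 / (y * y)) (hscale B y (hscale B x a + hscale B y b))"
        using False by (simp add: scale_right_distrib)
      also have "\<dots> = hscale B (x / y) (hscale B (x / y) c + d)"
        unfolding line using False by (simp add: scale_right_distrib)
      finally show "z * a + b = z * (z * c + d)" by (simp add: z)
      show "u = 0" if "u + u = 0" for u :: 'b
      proof -
        have "hscale B 2 u = 0"
          using that unfolding one_add_one [symmetric] scale_left_distrib by simp
        then show ?thesis using two_neq_0_of_CHAR [OF assms(1)] by simp
      qed
    qed
  qed
  then show ?thesis by (simp add: c_def)
qed

theorem proposition8p3:
  fixes B :: "('k::alg_closed_field, 'b::ring_1) hopf"
    and B' :: "('k, 'c::ring_1) hopf"
    and \<pi> :: "'k sl2j \<Rightarrow> 'b" and \<psi> :: "'b \<Rightarrow> ('g::group_add \<Rightarrow>\<^sub>0 'k)"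
    and \<pi>' :: "'k sl2j \<Rightarrow> 'c" and \<psi>' :: "'c \<Rightarrow> ('g \<Rightarrow>\<^sub>0 'k)"
  assumes "CHAR('k) \<noteq> 2"
  shows "\<not> dense_big_cell sl2j B B' \<pi> \<psi> \<pi>' \<psi>'"
proof
  assume cell: "dense_big_cell sl2j B B' \<pi> \<psi> \<pi>' \<psi>'"
  define \<theta> where "\<theta> x = tmap (hvs B) (hvs B') \<pi> \<pi>' (comult sl2j x)" for x
  have inj: "inj \<theta>"
    using cell by (simp add: dense_big_cell_def \<theta>_def [abs_def])
  have lin: "Vector_Spaces.linear sl2j_scale (hscale B) \<pi>" "Vector_Spaces.linear sl2j_scale (hscale B') \<pi>'"
    using cell by (simp_all add: dense_big_cell_def hopf_hom_def)
  have c: "\<pi> (sl2j_gen Gc) = 0" "\<pi>' (sl2j_gen Gc) = 0"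
    using cell pointed_quotient_c_eq_0 [OF assms] by (auto simp: dense_big_cell_def)
  have "\<theta> (sl2j_gen Gc) = tcls (hvs B) (hvs B') (single (0, \<pi>' (sl2j_gen Ga)) 1 + single (\<pi> (sl2j_gen Gd), 0) 1)"
    unfolding \<theta>_def tmap_comult_sl2j(2) [OF lin]
    by (simp add: comult_gen_def Let_def fscale.linext_add c)
  also have "\<dots> = tcls (hvs B) (hvs B') 0"
    by (rule tcls_eqI) (simp add: kext_add kext_single kext_zero bilinD(5,6))
  also have "\<dots> = \<theta> 0"
    unfolding \<theta>_def tmap_comult_sl2j(1) [OF lin] ..
  finally have "sl2j_gen Gc = (0 :: 'k sl2j)"
    using inj by (simp add: inj_eq)
  with sl2j_gen_c_neq_0 show False ..
qed

end
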